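(* Let $G=(V,E)$ be a dynamic graph and let $\mathcal{P}$ be a connected graph on four vertices. Then one can (i) maintain $\mathbf{c}(G,\mathcal{P})$ in worst-case $O(m)$ update time and constant space; (ii) query $\mathbf{c}(G,\mathcal{P},\{u,v\})$ for an arbitrary edge $\{u,v\}\in E$ in worst-case $O(m)$ time, with constant update time and space; (iii) query $\mathbf{c}(G,\mathcal{P},\{u,v\})$ for an arbitrary edge $\{u,v\}\in E$ in worst-case constant time, with $O(m)$ worst-case update time and $O(m)$ space.
   Context: A dynamic graph $G=(V,E)$ is a simple undirected graph on a fixed vertex set $V$ with $n=|V|$ vertices that undergoes edge insertions and deletions; $m$ denotes the current number of edges. The algorithm can access the degree of a vertex and test adjacency of two vertices in constant time. For a pattern graph $\mathcal{P}$, $\mathbf{c}(G,\mathcal{P})$ is the number of (not necessarily induced) subgraphs of $G$ isomorphic to $\mathcal{P}$, and for an edge $e$, $\mathbf{c}(G,\mathcal{P},e)$ is the number of such subgraphs containing $e$. "Maintaining" a count means it can be retrieved by a query in constant time after every update. Space refers to the space used in addition to the graph representation. *)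

theory Defs
  imports Main
begin

section \<open>Simple undirected graphs and subgraph counts\<close>

type_synonym 'a ugraph = "'a set \<times> 'a set set"

abbreviation verts :: "'a ugraph \<Rightarrow> 'a set" where "verts G \<equiv> fst G"

abbreviation edges :: "'a ugraph \<Rightarrow> 'a set set" where "edges G \<equiv> snd G"

definition simple_graph :: "'a ugraph \<Rightarrow> bool" where
  "simple_graph G \<longleftrightarrow> finite (verts G) \<and> (\<forall>e\<in>edges G. e \<subseteq> verts G \<and> card e = 2)"

definition connected_graph :: "'a ugraph \<Rightarrow> bool" where
  "connected_graph G \<longleftrightarrow> verts G \<noteq> {} \<and>
     (\<forall>u\<in>verts G. \<forall>v\<in>verts G. (u, v) \<in> {(x, y). {x, y} \<in> edges G}\<^sup>*)"

definition subgraph_of :: "'a ugraph \<Rightarrow> 'a ugraph \<Rightarrow> bool" where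
  "subgraph_of H G \<longleftrightarrow> simple_graph H \<and> verts H \<subseteq> verts G \<and> edges H \<subseteq> edges G"

definition graph_iso :: "'a ugraph \<Rightarrow> 'b ugraph \<Rightarrow> bool" where
  "graph_iso G H \<longleftrightarrow> (\<exists>f. bij_betw f (verts G) (verts H) \<and>
     (\<forall>u\<in>verts G. \<forall>v\<in>verts G. {u, v} \<in> edges G \<longleftrightarrow> {f u, f v} \<in> edges H))"

definition subgraph_count :: "'a ugraph \<Rightarrow> 'b ugraph \<Rightarrow> nat" where
  "subgraph_count G P = card {H. subgraph_of H G \<and> graph_iso H P}"

definition subgraph_count_at :: "'a ugraph \<Rightarrow> 'b ugraph \<Rightarrow> 'a set \<Rightarrow> nat" where
  "subgraph_count_at G P e = card {H. subgraph_of H G \<and> graph_iso H P \<and> e \<in> edges H}"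


section \<open>Representation of the dynamic graph\<close>

text \<open>
  The vertices are \<open>0, \<dots>, n - 1\<close>.  The current edges are kept in an array, each as a pair of
  endpoints in either order.  An inserted edge is appended; when an edge is deleted, the last edge
  of the array takes over its position.  The array belongs to the graph representation: programs
  can read it but not change it, and it does not count as space used by the algorithm.
\<close>

type_synonym edge_array = "(nat \<times> nat) list"

definition uedge :: "nat \<times> nat \<Rightarrow> nat set" where
  "uedge p = {fst p, snd p}"

definition graph_of :: "nat \<Rightarrow> edge_array \<Rightarrow> nat ugraph" where
  "graph_of n es = ({..<n}, uedge ` set es)"

definition represents_graph :: "nat \<Rightarrow> edge_array \<Rightarrow> bool" where
  "represents_graph n es \<longleftrightarrow> distinct (map uedge es) \<and> (\<forall>(u, v)\<in>set es. u < n \<and> v < n \<and> u \<noteq> v)"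

definition degree :: "edge_array \<Rightarrow> nat \<Rightarrow> nat" where
  "degree es v = card {e \<in> uedge ` set es. v \<in> e}"

definition edge_pos :: "edge_array \<Rightarrow> nat \<Rightarrow> nat \<Rightarrow> nat" where
  "edge_pos es u v = length (takeWhile (\<lambda>p. uedge p \<noteq> {u, v}) es)"

definition insert_edge :: "nat \<Rightarrow> nat \<Rightarrow> edge_array \<Rightarrow> edge_array" where
  "insert_edge u v es = es @ [(u, v)]"

definition delete_edge :: "nat \<Rightarrow> nat \<Rightarrow> edge_array \<Rightarrow> edge_array" where
  "delete_edge u v es = (butlast es)[edge_pos es u v := last es]"


section \<open>A word RAM with access to the graph\<close>

text \<open>
  \<open>Adj\<close> is the adjacency test, \<open>Pos\<close> the position of an edge in the edge array (the number of edges
  if there is no such edge), and \<open>End1\<close>, \<open>End2\<close> are the endpoints of the edge at a given position.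
\<close>

datatype aexp =
    Const nat | Reg nat | Mem aexp
  | NumV | NumE | Deg aexp | Adj aexp aexp | Pos aexp aexp | End1 aexp | End2 aexp
  | Plus aexp aexp | Minus aexp aexp | Times aexp aexp | Div aexp aexp | Mod aexp aexp
  | Equal aexp aexp | Less aexp aexp

text \<open>
  \<open>Grow\<close> and \<open>Shrink\<close> allocate and release the last memory cell.
\<close>

datatype com =
    Skip
  | Assign nat aexp
  | Store aexp aexp
  | Grow
  | Shrink
  | Seq com com
  | If aexp com com
  | While aexp com

record machine =
  regs :: "nat \<Rightarrow> nat"
  mem :: "nat list"

definition start :: machine where
  "start = \<lparr>regs = (\<lambda>_. 0), mem = []\<rparr>"

definition nth_or_0 :: "nat list \<Rightarrow> nat \<Rightarrow> nat" where
  "nth_or_0 xs i = (if i < length xs then xs ! i else 0)"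

fun aval :: "nat \<Rightarrow> edge_array \<Rightarrow> machine \<Rightarrow> aexp \<Rightarrow> nat" where
  "aval n es \<sigma> (Const k) = k"
| "aval n es \<sigma> (Reg r) = regs \<sigma> r"
| "aval n es \<sigma> (Mem a) = nth_or_0 (mem \<sigma>) (aval n es \<sigma> a)"
| "aval n es \<sigma> NumV = n"
| "aval n es \<sigma> NumE = length es"
| "aval n es \<sigma> (Deg a) = degree es (aval n es \<sigma> a)"
| "aval n es \<sigma> (Adj a b) = of_bool ({aval n es \<sigma> a, aval n es \<sigma> b} \<in> edges (graph_of n es))"
| "aval n es \<sigma> (Pos a b) = edge_pos es (aval n es \<sigma> a) (aval n es \<sigma> b)"
| "aval n es \<sigma> (End1 a) = nth_or_0 (map fst es) (aval n es \<sigma> a)"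
| "aval n es \<sigma> (End2 a) = nth_or_0 (map snd es) (aval n es \<sigma> a)"
| "aval n es \<sigma> (Plus a b) = aval n es \<sigma> a + aval n es \<sigma> b"
| "aval n es \<sigma> (Minus a b) = aval n es \<sigma> a - aval n es \<sigma> b"
| "aval n es \<sigma> (Times a b) = aval n es \<sigma> a * aval n es \<sigma> b"
| "aval n es \<sigma> (Div a b) = aval n es \<sigma> a div aval n es \<sigma> b"
| "aval n es \<sigma> (Mod a b) = aval n es \<sigma> a mod aval n es \<sigma> b"
| "aval n es \<sigma> (Equal a b) = of_bool (aval n es \<sigma> a = aval n es \<sigma> b)"
| "aval n es \<sigma> (Less a b) = of_bool (aval n es \<sigma> a < aval n es \<sigma> b)"

text \<open>Every node of an expression costs one time unit.\<close>

fun acost :: "aexp \<Rightarrow> nat" where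
  "acost (Const k) = 1"
| "acost (Reg r) = 1"
| "acost (Mem a) = acost a + 1"
| "acost NumV = 1"
| "acost NumE = 1"
| "acost (Deg a) = acost a + 1"
| "acost (Adj a b) = acost a + acost b + 1"
| "acost (Pos a b) = acost a + acost b + 1"
| "acost (End1 a) = acost a + 1"
| "acost (End2 a) = acost a + 1"
| "acost (Plus a b) = acost a + acost b + 1"
| "acost (Minus a b) = acost a + acost b + 1"
| "acost (Times a b) = acost a + acost b + 1"
| "acost (Div a b) = acost a + acost b + 1"
| "acost (Mod a b) = acost a + acost b + 1"
| "acost (Equal a b) = acost a + acost b + 1"
| "acost (Less a b) = acost a + acost b + 1"

text \<open>
  \<open>run W n es c \<sigma> t s \<sigma>'\<close>: program \<open>c\<close>, started in \<open>\<sigma>\<close> on the graph given by \<open>n\<close> and \<open>es\<close>,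
  terminates in \<open>\<sigma>'\<close> after \<open>t\<close> time units, and \<open>s\<close> is the largest number of allocated memory cells
  at any time of the execution.  A program mentions only finitely many registers, so these
  contribute a constant to the space.  A machine word holds the numbers below \<open>W\<close>; execution gets
  stuck on an attempt to write a larger number or to write to a cell that is not allocated.
\<close>

inductive run :: "nat \<Rightarrow> nat \<Rightarrow> edge_array \<Rightarrow> com \<Rightarrow> machine \<Rightarrow> nat \<Rightarrow> nat \<Rightarrow> machine \<Rightarrow> bool"
  for W :: nat and n :: nat and es :: edge_array
where
  run_Skip: "run W n es Skip \<sigma> 1 (length (mem \<sigma>)) \<sigma>"
| run_Assign: "aval n es \<sigma> a < W \<Longrightarrow>
    run W n es (Assign r a) \<sigma> (acost a + 1) (length (mem \<sigma>))
      (\<sigma>\<lparr>regs := (regs \<sigma>)(r := aval n es \<sigma> a)\<rparr>)"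
| run_Store: "aval n es \<sigma> a < length (mem \<sigma>) \<Longrightarrow> aval n es \<sigma> b < W \<Longrightarrow>
    run W n es (Store a b) \<sigma> (acost a + acost b + 1) (length (mem \<sigma>))
      (\<sigma>\<lparr>mem := (mem \<sigma>)[aval n es \<sigma> a := aval n es \<sigma> b]\<rparr>)"
| run_Grow: "run W n es Grow \<sigma> 1 (length (mem \<sigma>) + 1) (\<sigma>\<lparr>mem := mem \<sigma> @ [0]\<rparr>)"
| run_Shrink: "run W n es Shrink \<sigma> 1 (length (mem \<sigma>)) (\<sigma>\<lparr>mem := butlast (mem \<sigma>)\<rparr>)"
| run_Seq: "run W n es c1 \<sigma> t1 s1 \<sigma>' \<Longrightarrow> run W n es c2 \<sigma>' t2 s2 \<sigma>'' \<Longrightarrow>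
    run W n es (Seq c1 c2) \<sigma> (t1 + t2) (max s1 s2) \<sigma>''"
| run_If_true: "aval n es \<sigma> b \<noteq> 0 \<Longrightarrow> run W n es c1 \<sigma> t s \<sigma>' \<Longrightarrow>
    run W n es (If b c1 c2) \<sigma> (acost b + 1 + t) s \<sigma>'"
| run_If_false: "aval n es \<sigma> b = 0 \<Longrightarrow> run W n es c2 \<sigma> t s \<sigma>' \<Longrightarrow>
    run W n es (If b c1 c2) \<sigma> (acost b + 1 + t) s \<sigma>'"
| run_While_true: "aval n es \<sigma> b \<noteq> 0 \<Longrightarrow> run W n es c \<sigma> t1 s1 \<sigma>' \<Longrightarrow>
    run W n es (While b c) \<sigma>' t2 s2 \<sigma>'' \<Longrightarrow>
    run W n es (While b c) \<sigma> (acost b + 1 + t1 + t2) (max s1 s2) \<sigma>''"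
| run_While_false: "aval n es \<sigma> b = 0 \<Longrightarrow>
    run W n es (While b c) \<sigma> (acost b + 1) (length (mem \<sigma>)) \<sigma>"


section \<open>Dynamic algorithms\<close>

text \<open>
  On an update, the algorithm may run one program on the old graph and one on the new graph.
\<close>

record dyn_alg =
  init_prog :: com
  ins_before :: com
  ins_after :: com
  del_before :: com
  del_after :: com
  query_prog :: com

datatype operation = Insert nat nat | Delete nat nat | Query "nat list"

text \<open>Arguments are passed in the first registers, all other words are preserved between programs.\<close>

definition load :: "nat list \<Rightarrow> machine \<Rightarrow> machine" where
  "load xs \<sigma> = \<sigma>\<lparr>regs := (\<lambda>r. if r < length xs then xs ! r else regs \<sigma> r)\<rparr>"

definition result :: "machine \<Rightarrow> nat" where
  "result \<sigma> = regs \<sigma> 0"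

inductive perform :: "nat \<Rightarrow> nat \<Rightarrow> dyn_alg \<Rightarrow> operation \<Rightarrow> edge_array \<Rightarrow> machine \<Rightarrow>
    nat \<Rightarrow> nat \<Rightarrow> edge_array \<Rightarrow> machine \<Rightarrow> bool"
  for W :: nat and n :: nat and D :: dyn_alg
where
  perform_Insert: "run W n es (ins_before D) (load [u, v] \<sigma>) t1 s1 \<sigma>' \<Longrightarrow>
    es' = insert_edge u v es \<Longrightarrow>
    run W n es' (ins_after D) (load [u, v] \<sigma>') t2 s2 \<sigma>'' \<Longrightarrow>
    perform W n D (Insert u v) es \<sigma> (t1 + t2) (max s1 s2) es' \<sigma>''"
| perform_Delete: "run W n es (del_before D) (load [u, v] \<sigma>) t1 s1 \<sigma>' \<Longrightarrow>
    es' = delete_edge u v es \<Longrightarrow>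
    run W n es' (del_after D) (load [u, v] \<sigma>') t2 s2 \<sigma>'' \<Longrightarrow>
    perform W n D (Delete u v) es \<sigma> (t1 + t2) (max s1 s2) es' \<sigma>''"
| perform_Query: "run W n es (query_prog D) (load xs \<sigma>) t s \<sigma>' \<Longrightarrow>
    perform W n D (Query xs) es \<sigma> t s es \<sigma>'"

fun admissible :: "(nat ugraph \<Rightarrow> nat list \<Rightarrow> bool) \<Rightarrow> nat ugraph \<Rightarrow> operation \<Rightarrow> bool" where
  "admissible legal G (Insert u v) \<longleftrightarrow> u \<in> verts G \<and> v \<in> verts G \<and> u \<noteq> v \<and> {u, v} \<notin> edges G"
| "admissible legal G (Delete u v) \<longleftrightarrow> {u, v} \<in> edges G"
| "admissible legal G (Query xs) \<longleftrightarrow> legal G xs"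

text \<open>
  The configurations that arise from some initial graph by some sequence of admissible updates
  and queries.
\<close>

inductive reachable :: "nat \<Rightarrow> nat \<Rightarrow> dyn_alg \<Rightarrow> (nat ugraph \<Rightarrow> nat list \<Rightarrow> bool) \<Rightarrow>
    edge_array \<Rightarrow> machine \<Rightarrow> bool"
  for W :: nat and n :: nat and D :: dyn_alg and legal :: "nat ugraph \<Rightarrow> nat list \<Rightarrow> bool"
where
  reachable_init: "represents_graph n es \<Longrightarrow> run W n es (init_prog D) start t s \<sigma> \<Longrightarrow>
    reachable W n D legal es \<sigma>"
| reachable_step: "reachable W n D legal es \<sigma> \<Longrightarrow> admissible legal (graph_of n es) x \<Longrightarrow>
    perform W n D x es \<sigma> t s es' \<sigma>' \<Longrightarrow> reachable W n D legal es' \<sigma>'"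

fun op_bound :: "(nat \<Rightarrow> nat) \<Rightarrow> (nat \<Rightarrow> nat) \<Rightarrow> operation \<Rightarrow> (nat \<Rightarrow> nat)" where
  "op_bound U Q (Insert u v) = U"
| "op_bound U Q (Delete u v) = U"
| "op_bound U Q (Query xs) = Q"

text \<open>
  \<open>dyn_solvable legal answer U Q S\<close>: some algorithm answers every legal query correctly, with
  worst-case update time \<open>O(U m)\<close>, query time \<open>O(Q m)\<close> and space \<open>O(S m)\<close>, where \<open>m\<close> is the current
  number of edges.  Algorithm and constant do not depend on \<open>n\<close> or the graph; words have
  \<open>O(log n)\<close> bits.  The initial graph is arbitrary; processing it may take as long as inserting its
  edges one by one, hence constant time if it has no edges.
\<close>

definition dyn_solvable :: "(nat ugraph \<Rightarrow> nat list \<Rightarrow> bool) \<Rightarrow> (nat ugraph \<Rightarrow> nat list \<Rightarrow> nat) \<Rightarrow>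
    (nat \<Rightarrow> nat) \<Rightarrow> (nat \<Rightarrow> nat) \<Rightarrow> (nat \<Rightarrow> nat) \<Rightarrow> bool" where
  "dyn_solvable legal answer U Q S \<longleftrightarrow>
    (\<exists>D C. \<forall>n W. W = (n + 2) ^ C \<longrightarrow>
      (\<forall>es. represents_graph n es \<longrightarrow>
        (\<exists>t s \<sigma>. run W n es (init_prog D) start t s \<sigma> \<and>
          t \<le> C * ((length es + 1) * U (length es)) \<and> s \<le> C * S (length es))) \<and>
      (\<forall>es \<sigma> x. reachable W n D legal es \<sigma> \<longrightarrow> admissible legal (graph_of n es) x \<longrightarrow>
        (\<exists>t s es' \<sigma>'. perform W n D x es \<sigma> t s es' \<sigma>' \<and>
          t \<le> C * op_bound U Q x (length es') \<and> s \<le> C * S (length es') \<and>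
          (\<forall>xs. x = Query xs \<longrightarrow> result \<sigma>' = answer (graph_of n es) xs))))"

definition count_solvable :: "'a ugraph \<Rightarrow> (nat \<Rightarrow> nat) \<Rightarrow> (nat \<Rightarrow> nat) \<Rightarrow> (nat \<Rightarrow> nat) \<Rightarrow> bool" where
  "count_solvable P = dyn_solvable (\<lambda>G xs. xs = []) (\<lambda>G xs. subgraph_count G P)"

definition edge_count_solvable :: "'a ugraph \<Rightarrow> (nat \<Rightarrow> nat) \<Rightarrow> (nat \<Rightarrow> nat) \<Rightarrow> (nat \<Rightarrow> nat) \<Rightarrow> bool"
  where
  "edge_count_solvable P = dyn_solvable
     (\<lambda>G xs. \<exists>u v. xs = [u, v] \<and> {u, v} \<in> edges G)
     (\<lambda>G xs. subgraph_count_at G P (set xs))"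

end

theory Submission
  imports Defs
begin

text \<open>
  Fix an edge \<open>uv\<close>. A copy of the pattern through \<open>uv\<close> lives on \<open>{u, v, x, y}\<close> and is given by a
  labelled edge set \<open>F\<close> on \<open>{0, 1, 2, 3}\<close> isomorphic to the pattern, under \<open>u, v, x, y\<close> for
  \<open>0, 1, 2, 3\<close>. If \<open>F\<close> contains the opposite edge \<open>{2, 3}\<close>, then \<open>xy\<close> is an edge, and one scan of the
  edge array finds all such copies. Otherwise the conditions on \<open>x\<close> and \<open>y\<close> are independent
  (joined to \<open>u\<close>, to \<open>v\<close>, to both, to neither), and the number of pairs \<open>x \<noteq> y\<close> is
  \<open>N(A) N(B) - N(A \<union> B)\<close>, where the four numbers \<open>N\<close> are \<open>n - 2\<close>, \<open>deg u - 1\<close>, \<open>deg v - 1\<close> and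
  the number of common neighbours. Hence the count at an edge takes \<open>O(m)\<close> time and no space, and
  the total changes by this count when \<open>uv\<close> is inserted or deleted.

  To keep the counts of all edges, let \<open>ab\<close> be the updated edge. The count at an edge \<open>e\<close> changes by
  the number of copies through both \<open>e\<close> and \<open>ab\<close>. If \<open>e\<close> is disjoint from \<open>ab\<close>, the four vertices are
  determined. If \<open>e = ax\<close>, the copies without \<open>xy\<close> are counted by the numbers \<open>N\<close> again, and those
  with \<open>xy\<close> are found when the scan reaches \<open>xy\<close> and are added to the counter of \<open>ax\<close>, which the edge
  array locates in constant time without any table indexed by vertices.
\<close>

section \<open>Copies of a pattern on four vertices\<close>

lemma graph_iso_sym:
  assumes "graph_iso G H"
  shows "graph_iso H G"
proof -
  obtain f where f: "bij_betw f (verts G) (verts H)"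
    and e: "\<forall>u\<in>verts G. \<forall>v\<in>verts G. {u, v} \<in> edges G \<longleftrightarrow> {f u, f v} \<in> edges H"
    using assms unfolding graph_iso_def by blast
  let ?g = "inv_into (verts G) f"
  have g: "bij_betw ?g (verts H) (verts G)"
    using f by (rule bij_betw_inv_into)
  have "{u, v} \<in> edges H \<longleftrightarrow> {?g u, ?g v} \<in> edges G" if "u \<in> verts H" "v \<in> verts H" for u v
    using e bij_betw_apply[OF g] that bij_betw_inv_into_right[OF f] by metis
  then show ?thesis
    unfolding graph_iso_def using g by blast
qed

lemma graph_iso_trans:
  assumes "graph_iso G H" and "graph_iso H K"
  shows "graph_iso G K"
proof -
  obtain f where f: "bij_betw f (verts G) (verts H)"
    and e: "\<forall>u\<in>verts G. \<forall>v\<in>verts G. {u, v} \<in> edges G \<longleftrightarrow> {f u, f v} \<in> edges H"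
    using assms(1) unfolding graph_iso_def by blast
  obtain g where g: "bij_betw g (verts H) (verts K)"
    and e': "\<forall>u\<in>verts H. \<forall>v\<in>verts H. {u, v} \<in> edges H \<longleftrightarrow> {g u, g v} \<in> edges K"
    using assms(2) unfolding graph_iso_def by blast
  have "\<forall>u\<in>verts G. \<forall>v\<in>verts G. {u, v} \<in> edges G \<longleftrightarrow> {(g \<circ> f) u, (g \<circ> f) v} \<in> edges K"
    using e e' bij_betw_apply[OF f] by simp
  then show ?thesis
    unfolding graph_iso_def using bij_betw_trans[OF f g] by blast
qed

lemma graph_iso_image:
  assumes inj: "inj_on p V" and F: "\<Union>F \<subseteq> V"
  shows "graph_iso (V, F) (p ` V, (`) p ` F)"
proof -
  have "{u, v} \<in> F \<longleftrightarrow> {p u, p v} \<in> (`) p ` F" if "u \<in> V" "v \<in> V" for u v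
  proof
    assume "{u, v} \<in> F"
    then have "p ` {u, v} \<in> (`) p ` F"
      by (rule imageI)
    then show "{p u, p v} \<in> (`) p ` F"
      by simp
  next
    assume "{p u, p v} \<in> (`) p ` F"
    then obtain e where e: "e \<in> F" "p ` {u, v} = p ` e"
      by auto
    then have "{u, v} = e"
      using inj_on_image_eq_iff[OF inj, of "{u, v}" e] that F by blast
    then show "{u, v} \<in> F"
      using e by simp
  qed
  then show ?thesis
    unfolding graph_iso_def using inj_on_imp_bij_betw[OF inj] by auto
qed

lemma graph_iso_card_verts: "graph_iso G H \<Longrightarrow> card (verts G) = card (verts H)"
  unfolding graph_iso_def using bij_betw_same_card by blast

text \<open>\<open>graph_iso\<close> only relates pairs of vertices. Edges of simple graphs are such
  pairs, so it induces a bijection of edge sets, and every copy has as many edges as the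
  pattern.\<close>

lemma graph_iso_card_edges:
  assumes "graph_iso G H" "simple_graph G" "simple_graph H"
  shows "card (edges G) = card (edges H)"
proof -
  obtain f where f: "bij_betw f (verts G) (verts H)"
    and e: "\<forall>u\<in>verts G. \<forall>v\<in>verts G. {u, v} \<in> edges G \<longleftrightarrow> {f u, f v} \<in> edges H"
    using assms(1) unfolding graph_iso_def by blast
  have "inj_on ((`) f) (edges G)"
    using inj_on_image_Pow[OF bij_betw_imp_inj_on[OF f]] assms(2)
    by (auto simp: simple_graph_def intro: inj_on_subset)
  moreover have "(`) f ` edges G = edges H"
  proof (intro equalityI subsetI)
    fix d assume "d \<in> (`) f ` edges G"
    then obtain c where c: "c \<in> edges G" "d = f ` c" by blast
    moreover obtain u v where "c = {u, v}"
      using c assms(2) by (auto simp: simple_graph_def card_2_iff)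
    ultimately show "d \<in> edges H"
      using e assms(2) by (auto simp: simple_graph_def)
  next
    fix d assume d: "d \<in> edges H"
    then obtain x y where xy: "d = {x, y}" "x \<in> verts H" "y \<in> verts H"
      using assms(3) by (fastforce simp: simple_graph_def card_2_iff)
    then obtain u v where "x = f u" "y = f v" "u \<in> verts G" "v \<in> verts G"
      using bij_betw_imp_surj_on[OF f] by blast
    then have "{u, v} \<in> edges G" "d = f ` {u, v}"
      using e d xy by auto
    then show "d \<in> (`) f ` edges G" by blast
  qed
  ultimately show ?thesis
    using card_image by metis
qed

section \<open>Copies of a pattern and insertion of an edge\<close>

definition copies :: "'a ugraph \<Rightarrow> 'b ugraph \<Rightarrow> 'a ugraph set" where
  "copies G P = {H. subgraph_of H G \<and> graph_iso H P}"

lemma finite_copies: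
  assumes "simple_graph G"
  shows "finite (copies G P)"
proof -
  have "edges G \<subseteq> Pow (verts G)" "finite (verts G)"
    using assms by (auto simp: simple_graph_def)
  then have "finite (edges G)"
    using finite_subset by blast
  moreover have "copies G P \<subseteq> Pow (verts G) \<times> Pow (edges G)"
    by (auto simp: copies_def subgraph_of_def)
  ultimately show ?thesis
    using \<open>finite (verts G)\<close> by (meson finite_Pow_iff finite_SigmaI finite_subset)
qed

lemma subgraph_count_copies: "subgraph_count G P = card (copies G P)"
  by (simp add: subgraph_count_def copies_def)

lemma subgraph_count_at_copies: "subgraph_count_at G P e = card {H \<in> copies G P. e \<in> edges H}"
  by (simp add: subgraph_count_at_def copies_def conj_assoc)

text \<open>The amount by which the count at \<open>e\<close> changes when \<open>f\<close> is
  inserted or deleted, where \<open>G\<close> is the graph that contains \<open>f\<close>.\<close>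

definition joint_count :: "'a ugraph \<Rightarrow> 'b ugraph \<Rightarrow> 'a set \<Rightarrow> 'a set \<Rightarrow> nat" where
  "joint_count G P e f = card {H \<in> copies G P. e \<in> edges H \<and> f \<in> edges H}"

lemma copies_remove_edge:
  "f \<notin> E \<Longrightarrow> copies (V, E) P = {H \<in> copies (V, insert f E) P. f \<notin> edges H}"
  by (auto simp: copies_def subgraph_of_def)

text \<open>Split the copies in the larger graph by whether they contain \<open>f\<close>; those
  that do not are the copies in the smaller one. Deletions use the same equation read
  backwards.\<close>

lemma subgraph_count_insert:
  assumes "simple_graph (V, insert f E)" "f \<notin> E"
  shows "subgraph_count (V, insert f E) P =
    subgraph_count (V, E) P + subgraph_count_at (V, insert f E) P f"
proof -
  let ?C = "copies (V, insert f E) P"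
  have "card {H \<in> ?C. f \<notin> edges H} + card {H \<in> ?C. f \<in> edges H} = card ?C"
    using finite_copies[OF assms(1), of P]
    by (subst card_Un_disjoint[symmetric]) (auto intro: arg_cong[where f = card])
  then show ?thesis
    by (simp add: subgraph_count_copies subgraph_count_at_copies copies_remove_edge[OF assms(2)])
qed

lemma subgraph_count_at_insert:
  assumes "simple_graph (V, insert f E)" "f \<notin> E"
  shows "subgraph_count_at (V, insert f E) P e =
    subgraph_count_at (V, E) P e + joint_count (V, insert f E) P e f"
proof -
  let ?C = "copies (V, insert f E) P"
  have "card {H \<in> ?C. f \<notin> edges H \<and> e \<in> edges H} + card {H \<in> ?C. e \<in> edges H \<and> f \<in> edges H}
    = card {H \<in> ?C. e \<in> edges H}"
    using finite_copies[OF assms(1), of P]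
    by (subst card_Un_disjoint[symmetric]) (auto intro: arg_cong[where f = card])
  then show ?thesis
    by (simp add: joint_count_def subgraph_count_at_copies copies_remove_edge[OF assms(2)] conj_assoc)
qed

text \<open>Double counting of a relation. It is applied with \<open>k\<close> the number of pattern
  edges, with 2 and with 1.\<close>

lemma sum_card_incidences:
  assumes "finite A" "finite B" "\<And>b. b \<in> B \<Longrightarrow> card {a \<in> A. R a b} = k"
  shows "(\<Sum>a\<in>A. card {b \<in> B. R a b}) = k * card B"
  using sum_multicount[of A B R k] assms by simp

text \<open>Each copy is counted at each of its edges, of which it has as many as the pattern. The
  initial total is obtained from this by division.\<close>

lemma sum_subgraph_count_at:
  assumes G: "simple_graph G" and P: "simple_graph P"
  shows "(\<Sum>e\<in>edges G. subgraph_count_at G P e) = card (edges P) * subgraph_count G P"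
proof -
  have "edges G \<subseteq> Pow (verts G)" "finite (verts G)"
    using G by (auto simp: simple_graph_def)
  then have fin: "finite (edges G)"
    using finite_subset by blast
  have "card {e \<in> edges G. e \<in> edges H} = card (edges P)" if "H \<in> copies G P" for H
  proof -
    have "{e \<in> edges G. e \<in> edges H} = edges H"
      using that by (auto simp: copies_def subgraph_of_def)
    then show ?thesis
      using graph_iso_card_edges[of H P] that P by (simp add: copies_def subgraph_of_def)
  qed
  then show ?thesis
    unfolding subgraph_count_at_copies subgraph_count_copies
    by (intro sum_card_incidences fin finite_copies[OF G])
qed

section \<open>Labelled patterns on four vertices\<close>

definition K4 :: "nat set set" where
  "K4 = {e. e \<subseteq> {..<4} \<and> card e = 2}"

text \<open>These depend on \<open>P\<close> alone and are finitely many, so a program can contain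
  one term for each of them.\<close>

definition labelings :: "'b ugraph \<Rightarrow> nat set set set" where
  "labelings P = {F. F \<subseteq> K4 \<and> graph_iso ({..<4}, F) P}"

lemma K4_eq: "K4 = {{0, 1}, {0, 2}, {0, 3}, {1, 2}, {1, 3}, {2, 3}}"
proof -
  have "{i, j} \<in> {{0, 1}, {0, 2}, {0, 3}, {1, 2}, {1, 3}, {2, 3}}"
    if "i < 4" "j < 4" "i \<noteq> j" for i j :: nat
  proof -
    have "i = 0 \<or> i = 1 \<or> i = 2 \<or> i = 3" "j = 0 \<or> j = 1 \<or> j = 2 \<or> j = 3"
      using that by linarith+
    then show ?thesis
      using that by (auto simp: insert_commute)
  qed
  then have "K4 \<subseteq> {{0, 1}, {0, 2}, {0, 3}, {1, 2}, {1, 3}, {2, 3}}"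
    unfolding K4_def card_2_iff by (intro subsetI, elim CollectE conjE exE) simp
  moreover have "{{0, 1}, {0, 2}, {0, 3}, {1, 2}, {1, 3}, {2, 3}} \<subseteq> K4"
    unfolding K4_def by simp
  ultimately show ?thesis
    by (rule equalityI)
qed

lemma finite_K4: "finite K4"
  by (rule finite_subset[of _ "Pow {..<4}"]) (auto simp: K4_def)

lemma card_K4: "card K4 \<le> 6"
  using card_length[of "[{0, 1}, {0, 2}, {0, 3}, {1, 2}, {1, 3}, {2, 3 :: nat}]"]
  by (simp add: K4_eq)

lemma labelings_subset: "labelings P \<subseteq> Pow K4"
  by (auto simp: labelings_def)

lemma finite_labelings: "finite (labelings P)"
  using labelings_subset finite_K4 finite_subset by blast

text \<open>Six possible edges allow at most 2^6 edge sets. The constant enters the bounds on the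
  machine words.\<close>

lemma card_labelings: "card (labelings P) \<le> 2 ^ 6"
proof -
  have "card (labelings P) \<le> card (Pow K4)"
    using labelings_subset finite_K4 by (intro card_mono) (rule finite_Pow_iff[THEN iffD2])
  also have "\<dots> = 2 ^ card K4"
    by (simp add: card_Pow finite_K4)
  also have "\<dots> \<le> 2 ^ 6"
    using card_K4 by (intro power_increasing) auto
  finally show ?thesis .
qed

text \<open>Images and preimages under \<open>p\<close> translate between edge sets on the labels
  and subgraphs on the image of \<open>p\<close>. \<open>R\<close> prescribes edges that the counted
  copies contain.\<close>

lemma card_copies_on:
  assumes inj: "inj_on p {..<4}" and V: "p ` {..<4} \<subseteq> verts G" and R: "R \<subseteq> K4"
  shows "card {H \<in> copies G P. verts H = p ` {..<4} \<and> (`) p ` R \<subseteq> edges H} =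
    card {F \<in> labelings P. R \<subseteq> F \<and> (`) p ` F \<subseteq> edges G}"
    (is "card ?H = card ?F")
proof -
  have K4: "K4 \<subseteq> Pow {..<4}"
    by (auto simp: K4_def)
  have injK: "inj_on ((`) p) K4"
    using inj_on_image_Pow[OF inj] K4 by (rule inj_on_subset)
  let ?g = "\<lambda>F. (p ` {..<4}, (`) p ` F)"
  have "bij_betw ?g ?F ?H"
    unfolding bij_betw_def
  proof (intro conjI equalityI subsetI)
    show "inj_on ?g ?F"
      using inj_on_image_eq_iff[OF injK] by (intro inj_onI) (auto simp: labelings_def)
  next
    fix H assume "H \<in> ?g ` ?F"
    then obtain F where F: "F \<subseteq> K4" "graph_iso ({..<4}, F) P" "R \<subseteq> F" "(`) p ` F \<subseteq> edges G"
      and H: "H = ?g F"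
      by (auto simp: labelings_def)
    have "graph_iso ({..<4}, F) H"
      unfolding H using F(1) K4 by (intro graph_iso_image[OF inj]) auto
    then have "graph_iso H P"
      using F(2) graph_iso_sym graph_iso_trans by blast
    moreover have "card (p ` e) = 2" if "e \<in> F" for e
      using that F(1) card_image[OF inj_on_subset[OF inj], of e] by (auto simp: K4_def)
    then have "simple_graph H"
      unfolding simple_graph_def H using F(1) K4 by (auto intro!: imageI)
    ultimately show "H \<in> ?H"
      using F V by (auto simp: copies_def subgraph_of_def H)
  next
    fix H assume "H \<in> ?H"
    then have H: "simple_graph H" "edges H \<subseteq> edges G" "graph_iso H P" "verts H = p ` {..<4}"
      "(`) p ` R \<subseteq> edges H"
      by (auto simp: copies_def subgraph_of_def)
    \<comment> \<open>The inverse of \<open>?g\<close>: pull the edges of \<open>H\<close> back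
      along \<open>p\<close>.\<close>
    define F where "F = {e \<in> K4. p ` e \<in> edges H}"
    have "d \<in> (`) p ` F" if d: "d \<in> edges H" for d
    proof -
      have "d \<subseteq> p ` {..<4}" "card d = 2"
        using H d by (auto simp: simple_graph_def)
      then obtain e where e: "e \<subseteq> {..<4}" "d = p ` e"
        using subset_image_iff by metis
      then have "card e = 2"
        using card_image[OF inj_on_subset[OF inj], of e] \<open>card d = 2\<close> by simp
      then show ?thesis
        using e d by (auto simp: F_def K4_def)
    qed
    then have E: "(`) p ` F = edges H"
      by (auto simp: F_def)
    then have HF: "H = ?g F"
      using H(4) by (simp add: prod_eq_iff)
    have "graph_iso ({..<4}, F) H"
      unfolding HF using K4 by (intro graph_iso_image[OF inj]) (auto simp: F_def)
    then have "graph_iso ({..<4}, F) P"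
      using H(3) graph_iso_trans by blast
    then have "F \<in> ?F"
      using R H E by (auto simp: labelings_def F_def)
    then show "H \<in> ?g ` ?F"
      using HF by blast
  qed
  then show ?thesis
    by (simp add: bij_betw_same_card)
qed

text \<open>Polymorphic because it assigns vertices and, in \<open>ext_exp\<close>, also expressions
  to the labels.\<close>

definition quad :: "'v \<Rightarrow> 'v \<Rightarrow> 'v \<Rightarrow> 'v \<Rightarrow> nat \<Rightarrow> 'v" where
  "quad a b x y i = (if i = 0 then a else if i = 1 then b else if i = 2 then x else y)"

lemma quad_simps [simp]:
  "quad a b x y 0 = a" "quad a b x y (Suc 0) = b" "quad a b x y 2 = x" "quad a b x y 3 = y"
  by (simp_all add: quad_def)

lemma lessThan_4: "{..<4::nat} = {0, 1, 2, 3}"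
  by auto

lemma quad_image [simp]: "quad a b x y ` {..<4} = {a, b, x, y}"
  by (simp add: lessThan_4)

lemma inj_on_quad [simp]: "inj_on (quad a b x y) {..<4} \<longleftrightarrow> distinct [a, b, x, y]"
  by (auto simp: lessThan_4)

text \<open>For four distinct vertices of the graph, this counts the copies on exactly these
  vertices that contain the edges labelled by \<open>R\<close>. Only edge tests for labelled
  patterns occur, so an expression can compute it.\<close>

definition extensions :: "'v set set \<Rightarrow> 'b ugraph \<Rightarrow> nat set set \<Rightarrow> 'v \<Rightarrow> 'v \<Rightarrow> 'v \<Rightarrow> 'v \<Rightarrow> nat" where
  "extensions E P R a b x y = card {F \<in> labelings P. R \<subseteq> F \<and> (`) (quad a b x y) ` F \<subseteq> E}"

lemma extensions_le: "extensions E P R a b x y \<le> 2 ^ 6"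
  unfolding extensions_def
  by (rule order_trans[OF card_mono[OF finite_labelings] card_labelings]) auto

lemma card_copies_on_quad:
  assumes "distinct [a, b, x, y]" "{a, b, x, y} \<subseteq> verts G" "R \<subseteq> K4"
  shows "card {H \<in> copies G P. verts H = {a, b, x, y} \<and> (`) (quad a b x y) ` R \<subseteq> edges H} =
    extensions (edges G) P R a b x y"
  using card_copies_on[of "quad a b x y" G R P] assms by (simp add: extensions_def)

lemma copies_verts:
  assumes "H \<in> copies G P" "card (verts P) = 4"
  shows "card (verts H) = 4" "finite (verts H)" "verts H \<subseteq> verts G"
    "e \<in> edges H \<Longrightarrow> e \<subseteq> verts H"
  using assms graph_iso_card_verts[of H P]
  by (auto simp: copies_def subgraph_of_def simple_graph_def)

text \<open>A copy through \<open>uv\<close> has exactly two further vertices, which give two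
  ordered pairs \<open>(x, y)\<close>; this is the factor 2.\<close>

lemma double_subgraph_count_at:
  assumes G: "simple_graph G" and P: "card (verts P) = 4"
    and uv: "u \<in> verts G" "v \<in> verts G" "u \<noteq> v"
  shows "2 * subgraph_count_at G P {u, v} =
    (\<Sum>(x, y) | x \<in> verts G \<and> y \<in> verts G \<and> distinct [u, v, x, y]. extensions (edges G) P {{0, 1}} u v x y)"
    (is "_ = (\<Sum>(x, y)\<in>?A. _)")
proof -
  have fin: "finite ?A"
    by (rule finite_subset[of _ "verts G \<times> verts G"]) (use G in \<open>auto simp: simple_graph_def\<close>)
  let ?B = "{H \<in> copies G P. {u, v} \<in> edges H}"
  let ?R = "\<lambda>q H. verts H = {u, v, fst q, snd q}"
  have "card {q \<in> ?A. ?R q H} = 2" if "H \<in> ?B" for H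
  proof -
    note H = copies_verts[of H G P, OF _ P]
    have sub: "{u, v} \<subseteq> verts H" using that H(4) by blast
    then have "card (verts H - {u, v}) = 2"
      using that H(1) uv by (simp add: card_Diff_subset)
    then obtain s t where st: "verts H - {u, v} = {s, t}" "s \<noteq> t"
      by (auto simp: card_2_iff)
    then have V: "verts H = {u, v, s, t}" "distinct [u, v, s, t]"
      using sub uv by auto
    then have VG: "s \<in> verts G" "t \<in> verts G"
      using that H(3) by auto
    have key: "verts H = {u, v, x, y} \<longleftrightarrow> {s, t} = {x, y}" if "distinct [u, v, x, y]" for x y
    proof -
      have "{x, y} = {u, v, x, y} - {u, v}" using that by auto
      then show ?thesis using st(1) V(1) by metis
    qed
    have "{q \<in> ?A. ?R q H} = {q \<in> ?A. {s, t} = {fst q, snd q}}"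
      by (rule Collect_cong, rule conj_cong, rule refl, rule key) (simp add: split_def)
    also have "\<dots> = {(s, t), (t, s)}"
      using V(2) VG by (auto simp: doubleton_eq_iff)
    finally have "{q \<in> ?A. ?R q H} = {(s, t), (t, s)}" .
    then show ?thesis using st by simp
  qed
  then have "(\<Sum>q\<in>?A. card {H \<in> ?B. ?R q H}) = 2 * card ?B"
    using fin finite_copies[OF G, of P] by (intro sum_card_incidences) auto
  moreover have "(\<Sum>q\<in>?A. card {H \<in> ?B. ?R q H}) =
    (\<Sum>(x, y)\<in>?A. extensions (edges G) P {{0, 1}} u v x y)"
  proof (rule sum.cong[OF refl], clarify)
    fix x y assume "x \<in> verts G" "y \<in> verts G" "distinct [u, v, x, y]"
    then show "card {H \<in> ?B. ?R (x, y) H} = extensions (edges G) P {{0, 1}} u v x y"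
      using card_copies_on_quad[of u v x y G "{{0, 1}}" P] uv by (simp add: K4_eq conj_ac)
  qed
  ultimately show ?thesis
    by (simp add: subgraph_count_at_copies)
qed

text \<open>The two edges fix three vertices, so a copy determines its fourth vertex
  \<open>y\<close> and is counted once.\<close>

lemma joint_count_adjacent:
  assumes G: "simple_graph G" and P: "card (verts P) = 4" and d: "distinct [a, b, x]"
    and V: "a \<in> verts G" "b \<in> verts G" "x \<in> verts G"
  shows "joint_count G P {a, x} {a, b} =
    (\<Sum>y\<in>verts G - {a, b, x}. extensions (edges G) P {{0, 1}, {0, 2}} a b x y)"
proof -
  let ?A = "verts G - {a, b, x}"
  let ?B = "{H \<in> copies G P. {a, x} \<in> edges H \<and> {a, b} \<in> edges H}"
  let ?R = "\<lambda>y H. verts H = {a, b, x, y}"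
  have "card {y \<in> ?A. ?R y H} = 1" if "H \<in> ?B" for H
  proof -
    note H = copies_verts[of H G P, OF _ P]
    have sub: "{a, b, x} \<subseteq> verts H" using that H(4) by blast
    then have "card (verts H - {a, b, x}) = 1"
      using that H(1) d by (simp add: card_Diff_subset)
    then obtain s where s: "verts H - {a, b, x} = {s}"
      by (auto simp: card_1_singleton_iff)
    then have VH: "verts H = {a, b, x, s}" "distinct [a, b, x, s]"
      using sub d by auto
    have "verts H = {a, b, x, y} \<longleftrightarrow> s = y" if "y \<notin> {a, b, x}" for y
    proof -
      have "{y} = {a, b, x, y} - {a, b, x}" using that by auto
      then show ?thesis using s VH(1) by (metis singleton_inject)
    qed
    then have "{y \<in> ?A. ?R y H} = {s}"
      using VH \<open>H \<in> ?B\<close> H(3) by auto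
    then show ?thesis by simp
  qed
  then have "(\<Sum>y\<in>?A. card {H \<in> ?B. ?R y H}) = 1 * card ?B"
    using G finite_copies[OF G, of P] by (intro sum_card_incidences) (auto simp: simple_graph_def)
  moreover have "card {H \<in> ?B. ?R y H} = extensions (edges G) P {{0, 1}, {0, 2}} a b x y"
    if "y \<in> ?A" for y
    using card_copies_on_quad[of a b x y G "{{0, 1}, {0, 2}}" P] that d V
    by (auto simp: K4_eq conj_ac)
  ultimately show ?thesis
    by (simp add: joint_count_def)
qed

text \<open>Two disjoint edges already contain all four vertices of a copy.\<close>

lemma joint_count_disjoint:
  assumes P: "card (verts P) = 4" and d: "distinct [a, b, x, y]"
    and V: "{a, b, x, y} \<subseteq> verts G"
  shows "joint_count G P {x, y} {a, b} = extensions (edges G) P {{0, 1}, {2, 3}} a b x y"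
proof -
  have "verts H = {a, b, x, y}" if "H \<in> copies G P" "{x, y} \<in> edges H" "{a, b} \<in> edges H" for H
  proof -
    note H = copies_verts[OF that(1) P]
    have "{a, b, x, y} \<subseteq> verts H"
      using H(4)[OF that(2)] H(4)[OF that(3)] by blast
    moreover have "card {a, b, x, y} = 4" using d by simp
    ultimately show ?thesis
      using card_subset_eq[of "verts H" "{a, b, x, y}"] H by simp
  qed
  then have "{H \<in> copies G P. {x, y} \<in> edges H \<and> {a, b} \<in> edges H} =
    {H \<in> copies G P. verts H = {a, b, x, y} \<and> (`) (quad a b x y) ` {{0, 1}, {2, 3}} \<subseteq> edges H}"
    by auto
  then show ?thesis
    using card_copies_on_quad[OF d V, of "{{0, 1}, {2, 3}}" P] by (simp add: joint_count_def K4_eq)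
qed

section \<open>Total correctness and running time of programs\<close>

inductive_cases run_SkipE: "run W n es Skip \<sigma> t s \<sigma>'"
inductive_cases run_AssignE: "run W n es (Assign r a) \<sigma> t s \<sigma>'"
inductive_cases run_StoreE: "run W n es (Store a b) \<sigma> t s \<sigma>'"
inductive_cases run_GrowE: "run W n es Grow \<sigma> t s \<sigma>'"
inductive_cases run_ShrinkE: "run W n es Shrink \<sigma> t s \<sigma>'"
inductive_cases run_SeqE: "run W n es (Seq c1 c2) \<sigma> t s \<sigma>'"
inductive_cases run_IfE: "run W n es (If b c1 c2) \<sigma> t s \<sigma>'"
inductive_cases run_WhileE: "run W n es (While b c) \<sigma> t s \<sigma>'"

text \<open>\<open>wp\<close> asserts that one good run exists; determinism carries its
  postcondition over to every run, as the invariant of \<open>reachable\<close> requires.\<close>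

lemma run_deterministic:
  assumes "run W n es c \<sigma> t s \<sigma>'" and "run W n es c \<sigma> t2 s2 \<sigma>2"
  shows "\<sigma>2 = \<sigma>'"
  using assms
proof (induction arbitrary: t2 s2 \<sigma>2)
  case (run_Seq c1 \<sigma> t1 s1 \<sigma>' c2 t2 s2 \<sigma>'')
  then show ?case by (metis run_SeqE)
next
  case (run_While_true \<sigma> b c t1 s1 \<sigma>' t2 s2 \<sigma>'')
  from run_While_true.prems show ?case
    by (rule run_WhileE) (use run_While_true.hyps(1) run_While_true.IH in auto)
next
  case (run_While_false \<sigma> b c)
  from run_While_false.prems show ?case
    by (rule run_WhileE) (use run_While_false.hyps in auto)
next
  case (run_If_true \<sigma> b c1 t s \<sigma>' c2)
  from run_If_true.prems show ?case
    by (rule run_IfE) (metis run_If_true.IH run_If_true.hyps(1))+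
next
  case (run_If_false \<sigma> b c2 t s \<sigma>' c1)
  from run_If_false.prems show ?case
    by (rule run_IfE) (metis run_If_false.IH run_If_false.hyps(1) less_irrefl)+
qed (auto elim: run_SkipE run_AssignE run_StoreE run_GrowE run_ShrinkE)

text \<open>The clause for loops is a bound only for loops with at most \<open>m\<close> iterations.\<close>

fun com_cost :: "nat \<Rightarrow> com \<Rightarrow> nat" where
  "com_cost m Skip = 1"
| "com_cost m (Assign r a) = acost a + 1"
| "com_cost m (Store a b) = acost a + acost b + 1"
| "com_cost m Grow = 1"
| "com_cost m Shrink = 1"
| "com_cost m (Seq c1 c2) = com_cost m c1 + com_cost m c2"
| "com_cost m (If b c1 c2) = acost b + 1 + max (com_cost m c1) (com_cost m c2)"
| "com_cost m (While b c) = (m + 1) * (acost b + 1) + m * com_cost m c"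

fun loop_depth :: "com \<Rightarrow> nat" where
  "loop_depth (Seq c1 c2) = max (loop_depth c1) (loop_depth c2)"
| "loop_depth (If b c1 c2) = max (loop_depth c1) (loop_depth c2)"
| "loop_depth (While b c) = Suc (loop_depth c)"
| "loop_depth _ = 0"

lemma mult_power_le: "a \<le> b \<Longrightarrow> d \<le> e \<Longrightarrow> a * (m + 1) ^ d \<le> b * (m + 1) ^ e" for a b :: nat
  by (intro mult_le_mono power_increasing) auto

text \<open>The cost grows at most like a power of \<open>m + 1\<close> whose exponent is the
  nesting depth of the loops; the cost at \<open>m = 1\<close>, a constant of the program, serves as
  coefficient.\<close>

lemma com_cost_le: "com_cost m c \<le> com_cost 1 c * (m + 1) ^ loop_depth c"
proof (induction c)
  case (Seq c1 c2)
  let ?d = "max (loop_depth c1) (loop_depth c2)"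
  have "com_cost m c1 \<le> com_cost 1 c1 * (m + 1) ^ ?d" "com_cost m c2 \<le> com_cost 1 c2 * (m + 1) ^ ?d"
    by (rule order_trans[OF Seq.IH(1) mult_power_le] order_trans[OF Seq.IH(2) mult_power_le];
        simp)+
  then show ?case by (simp add: distrib_right)
next
  case (If b c1 c2)
  let ?d = "max (loop_depth c1) (loop_depth c2)" and ?M = "max (com_cost 1 c1) (com_cost 1 c2)"
  have "com_cost m c1 \<le> ?M * (m + 1) ^ ?d" "com_cost m c2 \<le> ?M * (m + 1) ^ ?d"
    by (rule order_trans[OF If.IH(1) mult_power_le] order_trans[OF If.IH(2) mult_power_le]; simp)+
  moreover have "acost b + 1 \<le> (acost b + 1) * (m + 1) ^ ?d"
    by (metis mult.right_neutral mult_le_mono2 one_le_power le_add2)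
  ultimately show ?case
    by (simp only: com_cost.simps loop_depth.simps distrib_right Suc_eq_plus1) linarith
next
  case (While b c)
  let ?d = "Suc (loop_depth c)"
  have "m * com_cost m c \<le> (m + 1) * (com_cost 1 c * (m + 1) ^ loop_depth c)"
    using While.IH by (intro mult_le_mono) auto
  then have "m * com_cost m c \<le> com_cost 1 c * (m + 1) ^ ?d"
    by (simp only: power_Suc mult_ac)
  \<comment> \<open>In the cost at \<open>m = 1\<close> the guard is charged twice, hence the factor
    2.\<close>
  moreover have "(m + 1) * (acost b + 1) \<le> 2 * (acost b + 1) * (m + 1) ^ ?d"
    using mult_le_mono[OF self_le_power[of "m + 1" ?d], of "acost b + 1" "2 * (acost b + 1)"]
    by (simp add: mult_ac)
  ultimately show ?case
    by (simp add: distrib_right)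
qed auto

section \<open>Total correctness with time and space bounds\<close>

text \<open>\<open>S\<close> is separate from the array, because on a deletion the program runs on
  the old array while its space is measured by the new one.\<close>

definition wp :: "nat \<Rightarrow> nat \<Rightarrow> edge_array \<Rightarrow> nat \<Rightarrow> com \<Rightarrow> (machine \<Rightarrow> bool) \<Rightarrow> machine \<Rightarrow> bool" where
  "wp W n es S c Q \<sigma> \<longleftrightarrow>
    (\<exists>t s \<sigma>'. run W n es c \<sigma> t s \<sigma>' \<and> t \<le> com_cost (length es) c \<and> s \<le> S \<and> Q \<sigma>')"

definition set_reg :: "nat \<Rightarrow> nat \<Rightarrow> machine \<Rightarrow> machine" where
  "set_reg r k \<sigma> = \<sigma>\<lparr>regs := (regs \<sigma>)(r := k)\<rparr>"

lemma set_reg_simps [simp]: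
  "regs (set_reg r k \<sigma>) = (regs \<sigma>)(r := k)"
  "mem (set_reg r k \<sigma>) = mem \<sigma>"
  by (simp_all add: set_reg_def)

lemma wp_Skip: "length (mem \<sigma>) \<le> S \<Longrightarrow> Q \<sigma> \<Longrightarrow> wp W n es S Skip Q \<sigma>"
  unfolding wp_def by (metis run_Skip com_cost.simps(1) order_refl)

lemma wp_Assign:
  "aval n es \<sigma> a < W \<Longrightarrow> length (mem \<sigma>) \<le> S \<Longrightarrow> Q (set_reg r (aval n es \<sigma> a) \<sigma>) \<Longrightarrow>
    wp W n es S (Assign r a) Q \<sigma>"
  unfolding wp_def set_reg_def by (metis run_Assign com_cost.simps(2) order_refl)

lemma wp_Store:
  "aval n es \<sigma> a < length (mem \<sigma>) \<Longrightarrow> aval n es \<sigma> b < W \<Longrightarrow> length (mem \<sigma>) \<le> S \<Longrightarrow>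
    Q (\<sigma>\<lparr>mem := (mem \<sigma>)[aval n es \<sigma> a := aval n es \<sigma> b]\<rparr>) \<Longrightarrow> wp W n es S (Store a b) Q \<sigma>"
  unfolding wp_def by (metis run_Store com_cost.simps(3) order_refl)

lemma wp_Grow:
  "length (mem \<sigma>) + 1 \<le> S \<Longrightarrow> Q (\<sigma>\<lparr>mem := mem \<sigma> @ [0]\<rparr>) \<Longrightarrow> wp W n es S Grow Q \<sigma>"
  unfolding wp_def by (metis run_Grow com_cost.simps(4) order_refl)

lemma wp_Shrink:
  "length (mem \<sigma>) \<le> S \<Longrightarrow> Q (\<sigma>\<lparr>mem := butlast (mem \<sigma>)\<rparr>) \<Longrightarrow> wp W n es S Shrink Q \<sigma>"
  unfolding wp_def by (metis run_Shrink com_cost.simps(5) order_refl)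

lemma wp_Seq:
  assumes "wp W n es S c1 (wp W n es S c2 Q) \<sigma>"
  shows "wp W n es S (Seq c1 c2) Q \<sigma>"
proof -
  obtain t1 s1 \<sigma>1 t2 s2 \<sigma>2 where
    "run W n es c1 \<sigma> t1 s1 \<sigma>1" "t1 \<le> com_cost (length es) c1" "s1 \<le> S"
    "run W n es c2 \<sigma>1 t2 s2 \<sigma>2" "t2 \<le> com_cost (length es) c2" "s2 \<le> S" "Q \<sigma>2"
    using assms unfolding wp_def by blast
  then show ?thesis
    unfolding wp_def
    by (intro exI[of _ "t1 + t2"] exI[of _ "max s1 s2"] exI[of _ \<sigma>2]) (auto intro: run_Seq)
qed

lemma wp_If:
  assumes "aval n es \<sigma> b \<noteq> 0 \<Longrightarrow> wp W n es S c1 Q \<sigma>" "aval n es \<sigma> b = 0 \<Longrightarrow> wp W n es S c2 Q \<sigma>"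
  shows "wp W n es S (If b c1 c2) Q \<sigma>"
proof (cases "aval n es \<sigma> b = 0")
  case True
  then obtain t s \<sigma>' where "run W n es c2 \<sigma> t s \<sigma>'" "t \<le> com_cost (length es) c2" "s \<le> S" "Q \<sigma>'"
    using assms(2) unfolding wp_def by blast
  then show ?thesis
    unfolding wp_def using run_If_false[OF True]
    by (intro exI[of _ "acost b + 1 + t"] exI[of _ s] exI[of _ \<sigma>']) auto
next
  case False
  then obtain t s \<sigma>' where "run W n es c1 \<sigma> t s \<sigma>'" "t \<le> com_cost (length es) c1" "s \<le> S" "Q \<sigma>'"
    using assms(1) unfolding wp_def by blast
  then show ?thesis
    unfolding wp_def using run_If_true[OF False]
    by (intro exI[of _ "acost b + 1 + t"] exI[of _ s] exI[of _ \<sigma>']) auto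
qed

lemma wp_mono: "wp W n es S c Q \<sigma> \<Longrightarrow> (\<And>\<sigma>'. Q \<sigma>' \<Longrightarrow> Q' \<sigma>') \<Longrightarrow> wp W n es S c Q' \<sigma>"
  unfolding wp_def by blast

definition For :: "nat \<Rightarrow> com \<Rightarrow> com" where
  "For r c = Seq (Assign r (Const 0))
    (While (Less (Reg r) NumE) (Seq c (Assign r (Plus (Reg r) (Const 1)))))"

lemma loop_depth_For [simp]: "loop_depth (For r c) = Suc (loop_depth c)"
  by (simp add: For_def)

text \<open>The counter is increased after the body, which must leave it unchanged; hence
  \<open>I (Suc i)\<close> is demanded of the state with the new counter. There are exactly as many
  iterations as edges, so \<open>com_cost\<close> bounds the time.\<close>

lemma wp_For:
  assumes W: "length es < W"
    and init: "I 0 (set_reg r 0 \<sigma>)"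
    and step: "\<And>i \<sigma>. i < length es \<Longrightarrow> I i \<sigma> \<Longrightarrow> regs \<sigma> r = i \<Longrightarrow>
      wp W n es S c (\<lambda>\<sigma>'. regs \<sigma>' r = i \<and> length (mem \<sigma>') \<le> S \<and> I (Suc i) (set_reg r (Suc i) \<sigma>')) \<sigma>"
    and space: "length (mem \<sigma>) \<le> S"
    and final: "\<And>\<sigma>'. I (length es) \<sigma>' \<Longrightarrow> regs \<sigma>' r = length es \<Longrightarrow> Q \<sigma>'"
  shows "wp W n es S (For r c) Q \<sigma>"
proof -
  let ?m = "length es"
  let ?b = "Less (Reg r) NumE" and ?c = "Seq c (Assign r (Plus (Reg r) (Const 1)))"
  have body: "wp W n es S ?c (\<lambda>\<sigma>'. regs \<sigma>' r = Suc i \<and> length (mem \<sigma>') \<le> S \<and> I (Suc i) \<sigma>') \<sigma>"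
    if "i < ?m" "I i \<sigma>" "regs \<sigma> r = i" for i \<sigma>
    using W that by (intro wp_Seq wp_mono[OF step[OF that]]) (auto intro!: wp_Assign)
  \<comment> \<open>Downward induction from the end of the loop; the bound counts the remaining
    iterations and one last evaluation of the guard.\<close>
  have loop: "\<exists>t s \<sigma>'. run W n es (While ?b ?c) \<sigma> t s \<sigma>' \<and>
      t \<le> (?m - i + 1) * (acost ?b + 1) + (?m - i) * com_cost ?m ?c \<and> s \<le> S \<and> Q \<sigma>'"
    if "i \<le> ?m" "I i \<sigma>" "regs \<sigma> r = i" "length (mem \<sigma>) \<le> S" for i \<sigma>
    using that
  proof (induction i arbitrary: \<sigma> rule: inc_induct)
    case base
    then have "aval n es \<sigma> ?b = 0" by simp
    from run_While_false[OF this, of W] show ?case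
      using base final by fastforce
  next
    case (step i)
    have b: "aval n es \<sigma> ?b \<noteq> 0" using step by simp
    obtain t1 s1 \<sigma>1 where 1: "run W n es ?c \<sigma> t1 s1 \<sigma>1" "t1 \<le> com_cost ?m ?c" "s1 \<le> S"
      "regs \<sigma>1 r = Suc i" "length (mem \<sigma>1) \<le> S" "I (Suc i) \<sigma>1"
      using body[of i \<sigma>] step unfolding wp_def by blast
    obtain t2 s2 \<sigma>2 where 2: "run W n es (While ?b ?c) \<sigma>1 t2 s2 \<sigma>2"
      "t2 \<le> (?m - Suc i + 1) * (acost ?b + 1) + (?m - Suc i) * com_cost ?m ?c" "s2 \<le> S" "Q \<sigma>2"
      using step.IH[of \<sigma>1] 1 by blast
    obtain k where k: "?m - i = Suc k" "?m - Suc i = k"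
      using step.hyps by (metis Suc_diff_Suc)
    have "acost ?b + 1 + t1 + t2 \<le> (?m - i + 1) * (acost ?b + 1) + (?m - i) * com_cost ?m ?c"
      using 1(2) 2(2) unfolding k by simp
    then show ?case
      using run_While_true[OF b 1(1) 2(1)] 1(3) 2(3,4)
      by (intro exI[of _ "acost ?b + 1 + t1 + t2"] exI[of _ "max s1 s2"] exI[of _ \<sigma>2]) simp
  qed
  show ?thesis
    unfolding For_def
  proof (rule wp_Seq, rule wp_Assign)
    show "wp W n es S (While ?b ?c) Q (set_reg r (aval n es \<sigma> (Const 0)) \<sigma>)"
      using loop[of 0 "set_reg r 0 \<sigma>"] init space unfolding wp_def by simp
  qed (use W space in auto)
qed

section \<open>Counting copies through one or two edges\<close>

text \<open>The flags \<open>s\<close>, \<open>t\<close> say whether adjacency to \<open>a\<close>, respectively \<open>b\<close>, is required.\<close>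

definition sat :: "'v set set \<Rightarrow> 'v \<Rightarrow> 'v \<Rightarrow> bool \<Rightarrow> bool \<Rightarrow> 'v \<Rightarrow> bool" where
  "sat E a b s t x \<longleftrightarrow> (s \<longrightarrow> {a, x} \<in> E) \<and> (t \<longrightarrow> {b, x} \<in> E)"

text \<open>One function gives all four numbers \<open>N\<close>, so that demands on
  \<open>x\<close> and \<open>y\<close> can be merged by disjunction of flags.\<close>

definition common :: "'v ugraph \<Rightarrow> 'v \<Rightarrow> 'v \<Rightarrow> bool \<Rightarrow> bool \<Rightarrow> nat" where
  "common G a b s t = card {x \<in> verts G - {a, b}. sat (edges G) a b s t x}"

lemma common_commute: "common G b a t s = common G a b s t"
  by (simp add: common_def sat_def insert_commute conj_commute)

text \<open>Only the edge \<open>{2, 3}\<close> couples \<open>x\<close> with \<open>y\<close>; all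
  other requirements concern one of them at a time.\<close>

lemma quad_image_subset_iff:
  assumes "F \<subseteq> K4"
  shows "(`) (quad a b x y) ` F \<subseteq> E \<longleftrightarrow> ({0, 1} \<in> F \<longrightarrow> {a, b} \<in> E) \<and>
    sat E a b ({0, 2} \<in> F) ({1, 2} \<in> F) x \<and> sat E a b ({0, 3} \<in> F) ({1, 3} \<in> F) y \<and>
    ({2, 3} \<in> F \<longrightarrow> {x, y} \<in> E)"
proof -
  have "(`) (quad a b x y) ` F \<subseteq> E \<longleftrightarrow> (\<forall>e\<in>K4. e \<in> F \<longrightarrow> quad a b x y ` e \<in> E)"
    using assms by blast
  then show ?thesis
    by (simp add: K4_eq sat_def) blast
qed

text \<open>Remove the diagonal from a product of two sets; on the diagonal both sets of demands
  apply. The subtraction is exact, as the removed part is contained in the product.\<close>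

lemma card_sat_pairs:
  assumes "finite (verts G)" "a \<noteq> b"
  shows "card {(x, y). x \<in> verts G \<and> y \<in> verts G \<and> distinct [a, b, x, y] \<and>
      sat (edges G) a b s t x \<and> sat (edges G) a b s' t' y} =
    common G a b s t * common G a b s' t' - common G a b (s \<or> s') (t \<or> t')"
proof -
  define X where "X = {x \<in> verts G - {a, b}. sat (edges G) a b s t x}"
  define Y where "Y = {x \<in> verts G - {a, b}. sat (edges G) a b s' t' x}"
  have fin: "finite X" "finite Y"
    using assms by (auto simp: X_def Y_def)
  have "{(x, y). x \<in> verts G \<and> y \<in> verts G \<and> distinct [a, b, x, y] \<and>
      sat (edges G) a b s t x \<and> sat (edges G) a b s' t' y} = X \<times> Y - (\<lambda>x. (x, x)) ` (X \<inter> Y)"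
    using assms by (auto simp: X_def Y_def)
  moreover have "card (X \<times> Y - (\<lambda>x. (x, x)) ` (X \<inter> Y)) = card (X \<times> Y) - card (X \<inter> Y)"
    using fin by (subst card_Diff_subset) (auto simp: card_image inj_on_def)
  moreover have "X \<inter> Y = {x \<in> verts G - {a, b}. sat (edges G) a b (s \<or> s') (t \<or> t') x}"
    by (auto simp: X_def Y_def sat_def)
  ultimately show ?thesis
    unfolding common_def X_def[symmetric] Y_def[symmetric] by (simp add: card_cartesian_product)
qed

section \<open>Splitting the counts by the edge opposite to the given one\<close>

definition oriented :: "'v ugraph \<Rightarrow> ('v \<times> 'v) set" where
  "oriented G = {(x, y). {x, y} \<in> edges G}"

definition off :: "'v \<Rightarrow> 'v \<Rightarrow> 'v \<Rightarrow> 'v \<Rightarrow> bool" where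
  "off a b x y \<longleftrightarrow> x \<noteq> a \<and> x \<noteq> b \<and> y \<noteq> a \<and> y \<noteq> b"

lemma simple_edgeD:
  assumes "simple_graph G" "{x, y} \<in> edges G"
  shows "x \<in> verts G" "y \<in> verts G" "x \<noteq> y"
  using assms by (auto simp: simple_graph_def)

lemma finite_oriented: "simple_graph G \<Longrightarrow> finite (oriented G)"
  by (rule finite_subset[of _ "verts G \<times> verts G"]) (auto simp: oriented_def simple_graph_def)

text \<open>Used with \<open>e = {2, 3}\<close>: the patterns with this edge require
  \<open>xy\<close> to be an edge, those without it leave \<open>x\<close> and \<open>y\<close>
  independent.\<close>

lemma extensions_insert:
  "extensions E P R a b x y = extensions E P (insert e R) a b x y +
    card {F \<in> {F \<in> labelings P. R \<subseteq> F \<and> e \<notin> F}. (`) (quad a b x y) ` F \<subseteq> E}"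
  unfolding extensions_def
  by (subst card_Un_disjoint[symmetric]) (auto simp: finite_labelings intro: arg_cong[where f = card])

text \<open>Lets a sum over vertices shrink to a sum over edges, which a scan of the array can
  evaluate.\<close>

lemma extensions_nonedge: "{2, 3} \<in> R \<Longrightarrow> {x, y} \<notin> E \<Longrightarrow> extensions E P R a b x y = 0"
  unfolding extensions_def card_eq_0_iff by (force simp: image_subset_iff)

text \<open>Twice the number of copies through \<open>uv\<close> that avoid the edge opposite to \<open>uv\<close>.\<close>

definition spread_count :: "'v ugraph \<Rightarrow> 'b ugraph \<Rightarrow> 'v \<Rightarrow> 'v \<Rightarrow> nat" where
  "spread_count G P u v = (\<Sum>F \<in> {F \<in> labelings P. {0, 1} \<in> F \<and> {2, 3} \<notin> F}.
    common G u v ({0, 2} \<in> F) ({1, 2} \<in> F) * common G u v ({0, 3} \<in> F) ({1, 3} \<in> F) -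
    common G u v ({0, 2} \<in> F \<or> {0, 3} \<in> F) ({1, 2} \<in> F \<or> {1, 3} \<in> F))"

text \<open>Patterns with the edge \<open>{2, 3}\<close> contribute only at oriented edges. For the
  others the order of summation is exchanged: each pattern then contributes a number of vertex
  pairs, which \<open>card_sat_pairs\<close> gives.\<close>

lemma double_subgraph_count_at_eq:
  assumes G: "simple_graph G" and P: "card (verts P) = 4" and uv: "{u, v} \<in> edges G"
  shows "2 * subgraph_count_at G P {u, v} =
    (\<Sum>(x, y)\<in>oriented G. of_bool (off u v x y) * extensions (edges G) P {{0, 1}, {2, 3}} u v x y)
    + spread_count G P u v"
proof -
  let ?A = "{(x, y). x \<in> verts G \<and> y \<in> verts G \<and> distinct [u, v, x, y]}"
  let ?L = "{F \<in> labelings P. {{0, 1}} \<subseteq> F \<and> {2, 3} \<notin> F}"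
  note uvD = simple_edgeD[OF G uv]
  have finV: "finite (verts G)"
    using G by (simp add: simple_graph_def)
  have fin: "finite ?A"
    by (rule finite_subset[of _ "verts G \<times> verts G"]) (use finV in auto)
  have "2 * subgraph_count_at G P {u, v} =
      (\<Sum>(x, y)\<in>?A. extensions (edges G) P {{0, 1}} u v x y)"
    using double_subgraph_count_at[OF G P uvD] .
  also have "\<dots> = (\<Sum>q\<in>?A. extensions (edges G) P {{2, 3}, {0, 1}} u v (fst q) (snd q)) +
      (\<Sum>q\<in>?A. card {F \<in> ?L. (`) (quad u v (fst q) (snd q)) ` F \<subseteq> edges G})"
    by (simp only: split_def extensions_insert[where R = "{{0, 1}}" and e = "{2, 3}"] sum.distrib)
  also have "(\<Sum>q\<in>?A. extensions (edges G) P {{2, 3}, {0, 1}} u v (fst q) (snd q)) =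
      (\<Sum>(x, y)\<in>oriented G. of_bool (off u v x y) * extensions (edges G) P {{0, 1}, {2, 3}} u v x y)"
  proof (rule sum.mono_neutral_cong)
    show "finite ?A" "finite (oriented G)"
      by (fact fin, fact finite_oriented[OF G])
    show "extensions (edges G) P {{2, 3}, {0, 1}} u v (fst q) (snd q) = 0"
      if "q \<in> ?A - oriented G" for q
      using that by (intro extensions_nonedge) (auto simp: oriented_def)
    show "(case q of (x, y) \<Rightarrow> of_bool (off u v x y) *
        extensions (edges G) P {{0, 1}, {2, 3}} u v x y) = 0" if "q \<in> oriented G - ?A" for q
      using that uvD simple_edgeD[OF G] by (force simp: oriented_def off_def)
    show "extensions (edges G) P {{2, 3}, {0, 1}} u v (fst q) (snd q) =
        (case q of (x, y) \<Rightarrow> of_bool (off u v x y) *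
        extensions (edges G) P {{0, 1}, {2, 3}} u v x y)" if "q \<in> ?A \<inter> oriented G" for q
      using that by (auto simp: off_def insert_commute)
  qed
  also have "(\<Sum>q\<in>?A. card {F \<in> ?L. (`) (quad u v (fst q) (snd q)) ` F \<subseteq> edges G}) =
      spread_count G P u v"
    unfolding spread_count_def
  proof (subst sum_multicount_gen)
    show "\<forall>F\<in>?L. card {q \<in> ?A. (`) (quad u v (fst q) (snd q)) ` F \<subseteq> edges G} =
      common G u v ({0, 2} \<in> F) ({1, 2} \<in> F) * common G u v ({0, 3} \<in> F) ({1, 3} \<in> F) -
      common G u v ({0, 2} \<in> F \<or> {0, 3} \<in> F) ({1, 2} \<in> F \<or> {1, 3} \<in> F)"
    proof
      fix F assume F: "F \<in> ?L"
      then have "F \<subseteq> K4" using labelings_subset by blast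
      then have "{q \<in> ?A. (`) (quad u v (fst q) (snd q)) ` F \<subseteq> edges G} =
        {(x, y). x \<in> verts G \<and> y \<in> verts G \<and> distinct [u, v, x, y] \<and>
          sat (edges G) u v ({0, 2} \<in> F) ({1, 2} \<in> F) x \<and>
          sat (edges G) u v ({0, 3} \<in> F) ({1, 3} \<in> F) y}"
        using F uv by (auto simp: quad_image_subset_iff)
      then show "card {q \<in> ?A. (`) (quad u v (fst q) (snd q)) ` F \<subseteq> edges G} =
        common G u v ({0, 2} \<in> F) ({1, 2} \<in> F) * common G u v ({0, 3} \<in> F) ({1, 3} \<in> F) -
        common G u v ({0, 2} \<in> F \<or> {0, 3} \<in> F) ({1, 2} \<in> F \<or> {1, 3} \<in> F)"
        by (simp only: card_sat_pairs[OF finV uvD(3)])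
    qed
  qed (use fin finite_labelings[of P] in auto)
  finally show ?thesis .
qed

text \<open>At most n^2 ordered pairs, each with at most 2^6 labelled patterns. This keeps the
  counts within a word.\<close>

lemma subgraph_count_at_le:
  assumes G: "simple_graph G" and P: "card (verts P) = 4" and e: "e \<in> edges G"
  shows "2 * subgraph_count_at G P e \<le> 2 ^ 6 * card (verts G) ^ 2"
proof -
  obtain u v where uv: "e = {u, v}" "u \<noteq> v"
    using G e by (auto simp: simple_graph_def card_2_iff)
  let ?A = "{(x, y). x \<in> verts G \<and> y \<in> verts G \<and> distinct [u, v, x, y]}"
  have finV: "finite (verts G)"
    using G by (simp add: simple_graph_def)
  have "2 * subgraph_count_at G P e = (\<Sum>(x, y)\<in>?A. extensions (edges G) P {{0, 1}} u v x y)"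
    unfolding uv(1) using e uv simple_edgeD[OF G, of u v]
    by (intro double_subgraph_count_at[OF G P]) auto
  also have "\<dots> \<le> card ?A * 2 ^ 6"
    using sum_bounded_above[of ?A "\<lambda>q. extensions (edges G) P {{0, 1}} u v (fst q) (snd q)" "2 ^ 6"]
    by (simp add: split_def extensions_le del: power_numeral)
  also have "card ?A \<le> card (verts G \<times> verts G)"
    using finV by (intro card_mono) auto
  finally show ?thesis
    by (simp add: card_cartesian_product power2_eq_square)
qed

text \<open>The number of copies through \<open>ab\<close> and \<open>ax\<close> that avoid the edge opposite to \<open>ab\<close>.\<close>

definition near_count :: "'v ugraph \<Rightarrow> 'b ugraph \<Rightarrow> 'v \<Rightarrow> 'v \<Rightarrow> 'v \<Rightarrow> nat" where
  "near_count G P a b x = (\<Sum>F \<in> {F \<in> labelings P. {0, 1} \<in> F \<and> {0, 2} \<in> F \<and> {2, 3} \<notin> F}.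
    of_bool (sat (edges G) a b ({0, 2} \<in> F) ({1, 2} \<in> F) x) *
    (common G a b ({0, 3} \<in> F) ({1, 3} \<in> F) -
     of_bool (sat (edges G) a b ({0, 3} \<in> F) ({1, 3} \<in> F) x)))"

text \<open>Again split by \<open>{2, 3}\<close>. Without that edge the condition on
  \<open>x\<close> is a fixed test and only \<open>y\<close> is free, so a single number
  \<open>common\<close> suffices for each pattern.\<close>

lemma joint_count_adjacent_eq:
  assumes G: "simple_graph G" and P: "card (verts P) = 4"
    and ab: "{a, b} \<in> edges G" and ax: "{a, x} \<in> edges G" and "x \<noteq> b"
  shows "joint_count G P {a, x} {a, b} = near_count G P a b x +
    (\<Sum>y | {x, y} \<in> edges G \<and> off a b x y. extensions (edges G) P {{0, 1}, {0, 2}, {2, 3}} a b x y)"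
proof -
  let ?A = "verts G - {a, b, x}"
  let ?L = "{F \<in> labelings P. {{0, 1}, {0, 2}} \<subseteq> F \<and> {2, 3} \<notin> F}"
  note abD = simple_edgeD[OF G ab] and axD = simple_edgeD[OF G ax]
  have finV: "finite (verts G)"
    using G by (simp add: simple_graph_def)
  have "joint_count G P {a, x} {a, b} =
      (\<Sum>y\<in>?A. extensions (edges G) P {{0, 1}, {0, 2}} a b x y)"
    using abD axD \<open>x \<noteq> b\<close> by (intro joint_count_adjacent[OF G P]) auto
  also have "\<dots> = (\<Sum>y\<in>?A. extensions (edges G) P {{2, 3}, {0, 1}, {0, 2}} a b x y) +
      (\<Sum>y\<in>?A. card {F \<in> ?L. (`) (quad a b x y) ` F \<subseteq> edges G})"
    by (simp only: extensions_insert[where R = "{{0, 1}, {0, 2}}" and e = "{2, 3}"] sum.distrib)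
  also have "(\<Sum>y\<in>?A. extensions (edges G) P {{2, 3}, {0, 1}, {0, 2}} a b x y) =
    (\<Sum>y | {x, y} \<in> edges G \<and> off a b x y. extensions (edges G) P {{0, 1}, {0, 2}, {2, 3}} a b x y)"
  proof (rule sum.mono_neutral_cong_right)
    show "finite ?A" using finV by simp
    show "{y. {x, y} \<in> edges G \<and> off a b x y} \<subseteq> ?A"
      using simple_edgeD(2,3)[OF G, of x] by (auto simp: off_def)
    show "\<forall>y\<in>?A - {y. {x, y} \<in> edges G \<and> off a b x y}.
        extensions (edges G) P {{2, 3}, {0, 1}, {0, 2}} a b x y = 0"
      using axD \<open>x \<noteq> b\<close> by (intro ballI extensions_nonedge) (auto simp: off_def)
  qed (simp add: insert_commute)
  also have "(\<Sum>y\<in>?A. card {F \<in> ?L. (`) (quad a b x y) ` F \<subseteq> edges G}) = near_count G P a b x"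
    unfolding near_count_def
  proof (subst sum_multicount_gen)
    show "\<forall>F\<in>?L. card {y \<in> ?A. (`) (quad a b x y) ` F \<subseteq> edges G} =
      of_bool (sat (edges G) a b ({0, 2} \<in> F) ({1, 2} \<in> F) x) *
      (common G a b ({0, 3} \<in> F) ({1, 3} \<in> F) -
       of_bool (sat (edges G) a b ({0, 3} \<in> F) ({1, 3} \<in> F) x))"
    proof
      fix F assume F: "F \<in> ?L"
      then have "F \<subseteq> K4" using labelings_subset by blast
      let ?s = "sat (edges G) a b ({0, 3} \<in> F) ({1, 3} \<in> F)"
      have "{y \<in> ?A. (`) (quad a b x y) ` F \<subseteq> edges G} =
        {y \<in> ?A. sat (edges G) a b ({0, 2} \<in> F) ({1, 2} \<in> F) x \<and> ?s y}"
        using F ab by (auto simp: quad_image_subset_iff[OF \<open>F \<subseteq> K4\<close>])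
      also have "card \<dots> = of_bool (sat (edges G) a b ({0, 2} \<in> F) ({1, 2} \<in> F) x) *
          card {y \<in> ?A. ?s y}"
        by simp
      \<comment> \<open>\<open>common\<close> also admits \<open>y = x\<close>, so one is subtracted
        when \<open>x\<close> itself meets the demands on \<open>y\<close>.\<close>
      also have "{y \<in> ?A. ?s y} = {y \<in> verts G - {a, b}. ?s y} - {y. y = x \<and> ?s y}"
        by auto
      also have "card \<dots> = common G a b ({0, 3} \<in> F) ({1, 3} \<in> F) - card {y. y = x \<and> ?s y}"
        unfolding common_def using axD \<open>x \<noteq> b\<close> by (intro card_Diff_subset) auto
      also have "card {y. y = x \<and> ?s y} = of_bool (?s x)"
        by (simp add: Collect_conv_if)
      finally show "card {y \<in> ?A. (`) (quad a b x y) ` F \<subseteq> edges G} =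
        of_bool (sat (edges G) a b ({0, 2} \<in> F) ({1, 2} \<in> F) x) *
        (common G a b ({0, 3} \<in> F) ({1, 3} \<in> F) - of_bool (?s x))" .
    qed
  qed (use finV finite_labelings[of P] in \<open>auto simp: conj_assoc\<close>)
  finally show ?thesis
    by (simp only: add.commute)
qed

section \<open>Distributing the change of the counts over a scan\<close>

text \<open>
  What the oriented edge \<open>(p, q)\<close> contributes to the counter of \<open>e\<close> when \<open>cd\<close> is updated; only edges
  \<open>e\<close> at \<open>c\<close> are served, so the update uses it for \<open>(c, d)\<close> and \<open>(d, c)\<close>.
\<close>

definition scatter_term :: "'v ugraph \<Rightarrow> 'b ugraph \<Rightarrow> 'v \<Rightarrow> 'v \<Rightarrow> 'v set \<Rightarrow> 'v \<Rightarrow> 'v \<Rightarrow> nat" where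
  "scatter_term G P c d e p q =
    of_bool (off c d p q \<and> e = {c, p}) * extensions (edges G) P {{0, 1}, {0, 2}, {2, 3}} c d p q +
    of_bool (p = c \<and> q \<noteq> d \<and> e = {p, q}) * near_count G P c d q"

definition scatter :: "'v ugraph \<Rightarrow> 'b ugraph \<Rightarrow> 'v \<Rightarrow> 'v \<Rightarrow> 'v set \<Rightarrow> nat" where
  "scatter G P c d e = (\<Sum>(p, q)\<in>oriented G. scatter_term G P c d e p q)"

text \<open>Both summands of \<open>scatter_term\<close> serve only edges that contain
  \<open>c\<close> and avoid \<open>d\<close>.\<close>

lemma scatter_eq_0: "c \<noteq> d \<Longrightarrow> c \<notin> e \<or> d \<in> e \<Longrightarrow> scatter G P c d e = 0"
  unfolding scatter_def
  by (rule sum.neutral) (auto simp: scatter_term_def off_def)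

text \<open>The oriented edges from \<open>z\<close> to the fourth vertex supply the copies with
  that edge, and \<open>(c, z)\<close> alone supplies \<open>near_count\<close>, once.\<close>

lemma scatter_eq_joint_count:
  assumes G: "simple_graph G" and P: "card (verts P) = 4"
    and cd: "{c, d} \<in> edges G" and cz: "{c, z} \<in> edges G" and "z \<noteq> d"
  shows "scatter G P c d {c, z} = joint_count G P {c, z} {c, d}"
proof -
  let ?f = "\<lambda>p q. extensions (edges G) P {{0, 1}, {0, 2}, {2, 3}} c d p q"
  note cdD = simple_edgeD[OF G cd] and czD = simple_edgeD[OF G cz]
  have eq: "{c, z} = {c, p} \<longleftrightarrow> p = z" for p
    by (auto simp: doubleton_eq_iff)
  have fin: "finite (oriented G)"
    by (rule finite_oriented[OF G])
  have "scatter G P c d {c, z} =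
    (\<Sum>q\<in>oriented G. of_bool (off c d (fst q) (snd q) \<and> fst q = z) * ?f (fst q) (snd q)) +
    (\<Sum>q\<in>oriented G. of_bool (q = (c, z)) * near_count G P c d z)"
    unfolding scatter_def scatter_term_def split_def sum.distrib
    by (rule arg_cong2[where f = "(+)"]; rule sum.cong)
      (use eq \<open>z \<noteq> d\<close> in \<open>auto simp: prod_eq_iff\<close>)
  also have "(\<Sum>q\<in>oriented G. of_bool (q = (c, z)) * near_count G P c d z) = near_count G P c d z"
  proof -
    have "(c, z) \<in> oriented G" using cz by (simp add: oriented_def)
    then show ?thesis
      using fin by (simp add: of_bool_def if_distrib[of "\<lambda>k. k * _"] sum.delta cong: if_cong)
  qed
  also have "(\<Sum>q\<in>oriented G. of_bool (off c d (fst q) (snd q) \<and> fst q = z) * ?f (fst q) (snd q)) =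
    (\<Sum>q\<in>Pair z ` {y. {z, y} \<in> edges G \<and> off c d z y}. ?f (fst q) (snd q))"
    using fin by (intro sum.mono_neutral_cong_right) (auto simp: oriented_def)
  also have "\<dots> = (\<Sum>y | {z, y} \<in> edges G \<and> off c d z y. ?f z y)"
    by (subst sum.reindex) (auto simp: inj_on_def)
  finally show ?thesis
    using joint_count_adjacent_eq[OF G P cd cz \<open>z \<noteq> d\<close>] by simp
qed

text \<open>An edge is disjoint from \<open>ab\<close>, equal to it, or shares exactly one end with
  it. At most one of the three summands survives, and it is the joint count; at \<open>ab\<close>
  itself all vanish.\<close>

lemma joint_count_eq_scatter:
  assumes G: "simple_graph G" and P: "card (verts P) = 4"
    and ab: "{a, b} \<in> edges G" and xy: "{x, y} \<in> edges G"
  shows "of_bool (off a b x y) * extensions (edges G) P {{0, 1}, {2, 3}} a b x y +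
      scatter G P a b {x, y} + scatter G P b a {x, y} =
    (if {x, y} = {a, b} then 0 else joint_count G P {x, y} {a, b})"
proof -
  note abD = simple_edgeD[OF G ab] and xyD = simple_edgeD[OF G xy]
  have ba: "{b, a} \<in> edges G" using ab by (simp add: insert_commute)
  consider "off a b x y" | "{x, y} = {a, b}"
    | z where "{x, y} = {a, z}" "z \<noteq> b" "z \<noteq> a" | z where "{x, y} = {b, z}" "z \<noteq> b" "z \<noteq> a"
    using xyD(3) by (auto simp: off_def doubleton_eq_iff)
  then show ?thesis
  proof cases
    case 1
    then have "distinct [a, b, x, y]" "{a, b, x, y} \<subseteq> verts G"
      using abD xyD by (auto simp: off_def)
    from joint_count_disjoint[OF P this] show ?thesis
      using 1 scatter_eq_0[of a b "{x, y}" G P] scatter_eq_0[of b a "{x, y}" G P] abD(3)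
      by (auto simp: off_def doubleton_eq_iff)
  next
    case 2
    then have "\<not> off a b x y" by (auto simp: off_def doubleton_eq_iff)
    then show ?thesis
      using 2 abD(3) by (simp add: scatter_eq_0)
  next
    case (3 z)
    then have "\<not> off a b x y" "{x, y} \<noteq> {a, b}" by (auto simp: off_def doubleton_eq_iff)
    moreover have "scatter G P b a {a, z} = 0"
      using abD(3) by (simp add: scatter_eq_0)
    ultimately show ?thesis
      using scatter_eq_joint_count[OF G P ab, of z] 3 xy by simp
  next
    case (4 z)
    then have "\<not> off a b x y" "{x, y} \<noteq> {a, b}" by (auto simp: off_def doubleton_eq_iff)
    moreover have "scatter G P a b {b, z} = 0"
      using abD(3) by (simp add: scatter_eq_0)
    ultimately show ?thesis
      using scatter_eq_joint_count[OF G P ba, of z] 4 xy by (simp add: insert_commute)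
  qed
qed

section \<open>Edge arrays and expressions\<close>

lemma verts_graph_of [simp]: "verts (graph_of n es) = {..<n}"
  and edges_graph_of: "edges (graph_of n es) = uedge ` set es"
  by (simp_all add: graph_of_def)

lemma graph_of_collapse [simp]: "({..<n}, edges (graph_of n es)) = graph_of n es"
  by (simp add: graph_of_def)

lemma represents_graph_simple:
  assumes "represents_graph n es"
  shows "simple_graph (graph_of n es)"
proof -
  have "{x, y} \<subseteq> {..<n} \<and> card {x, y} = 2" if "(x, y) \<in> set es" for x y
    using assms that by (auto simp: represents_graph_def)
  then show ?thesis
    by (auto simp: simple_graph_def graph_of_def uedge_def)
qed

lemma uedge_eq_iff:
  "represents_graph n es \<Longrightarrow> i < length es \<Longrightarrow> j < length es \<Longrightarrow>
    uedge (es ! i) = uedge (es ! j) \<longleftrightarrow> i = j"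
  using nth_eq_iff_index_eq[of "map uedge es" i j] by (simp add: represents_graph_def)

lemma represents_graph_nth:
  assumes "represents_graph n es" "i < length es" "es ! i = (x, y)"
  shows "x < n" "y < n" "x \<noteq> y" "{x, y} \<in> edges (graph_of n es)"
proof -
  have "(x, y) \<in> set es"
    using assms nth_mem by metis
  then show "x < n" "y < n" "x \<noteq> y" "{x, y} \<in> edges (graph_of n es)"
    using assms(1) imageI[of "(x, y)" "set es" uedge]
    by (auto simp: represents_graph_def edges_graph_of uedge_def)
qed

lemma edge_pos:
  assumes "{u, v} \<in> edges (graph_of n es)"
  shows "edge_pos es u v < length es" "uedge (es ! edge_pos es u v) = {u, v}"
proof -
  have less: "length (takeWhile R xs) < length xs" if "\<exists>x\<in>set xs. \<not> R x" for R and xs :: edge_array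
    using that by (induction xs) auto
  have "\<exists>p\<in>set es. \<not> uedge p \<noteq> {u, v}"
    using assms by (auto simp: edges_graph_of)
  then show len: "edge_pos es u v < length es"
    unfolding edge_pos_def by (rule less)
  show "uedge (es ! edge_pos es u v) = {u, v}"
    using nth_length_takeWhile[of "\<lambda>p. uedge p \<noteq> {u, v}" es] len
    unfolding edge_pos_def by blast
qed

lemma edge_pos_eq_iff:
  assumes "represents_graph n es" "{u, v} \<in> edges (graph_of n es)" "j < length es"
  shows "edge_pos es u v = j \<longleftrightarrow> uedge (es ! j) = {u, v}"
  using edge_pos[OF assms(2)] uedge_eq_iff[OF assms(1) edge_pos(1)[OF assms(2)] assms(3)] by auto

lemma length_le_square:
  assumes "represents_graph n es"
  shows "length es \<le> n ^ 2"
proof -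
  have "distinct es"
    using assms by (simp add: represents_graph_def distinct_map)
  then have "length es = card (set es)"
    by (simp add: distinct_card)
  also have "\<dots> \<le> card ({..<n} \<times> {..<n})"
    using assms by (intro card_mono) (auto simp: represents_graph_def)
  finally show ?thesis
    by (simp add: card_cartesian_product power2_eq_square)
qed

lemma sum_edge_array:
  assumes rep: "represents_graph n es"
  shows "(\<Sum>i<length es. f (uedge (es ! i))) = (\<Sum>e\<in>edges (graph_of n es). f e)"
proof -
  have "(\<Sum>i<length es. f (uedge (es ! i))) = sum_list (map f (map uedge es))"
    by (simp add: sum_list_sum_nth atLeast0LessThan)
  also have "\<dots> = sum f (set (map uedge es))"
    using rep by (intro sum_list_distinct_conv_sum_set) (simp add: represents_graph_def)
  finally show ?thesis
    by (simp add: edges_graph_of)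
qed

text \<open>Each edge is stored in one direction only, so the entries and their swaps partition the
  oriented edges. A scan that reads every entry both ways evaluates the sum.\<close>

lemma sum_oriented:
  fixes f :: "nat \<Rightarrow> nat \<Rightarrow> nat"
  assumes rep: "represents_graph n es"
  shows "(\<Sum>i<length es. f (fst (es ! i)) (snd (es ! i)) + f (snd (es ! i)) (fst (es ! i))) =
    (\<Sum>(x, y)\<in>oriented (graph_of n es). f x y)"
proof -
  have dist: "distinct (map uedge es)" and ne: "\<And>p. p \<in> set es \<Longrightarrow> fst p \<noteq> snd p"
    using rep by (auto simp: represents_graph_def)
  have inj: "inj_on uedge (set es)"
    using dist by (simp add: distinct_map)
  have swap: "uedge (prod.swap p) = uedge p" for p
    by (auto simp: uedge_def)
  have "prod.swap p \<notin> set es" if "p \<in> set es" for p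
    using inj_onD[OF inj swap _ that] ne[OF that] by (metis fst_swap)
  then have disj: "set es \<inter> prod.swap ` set es = {}"
    by auto
  have un: "oriented (graph_of n es) = set es \<union> prod.swap ` set es"
    by (force simp: oriented_def edges_graph_of uedge_def doubleton_eq_iff image_iff)
  have "(\<Sum>i<length es. f (fst (es ! i)) (snd (es ! i)) + f (snd (es ! i)) (fst (es ! i))) =
      sum_list (map (\<lambda>p. f (fst p) (snd p) + f (snd p) (fst p)) es)"
    by (simp add: sum_list_sum_nth atLeast0LessThan)
  also have "\<dots> = (\<Sum>p\<in>set es. f (fst p) (snd p) + f (snd p) (fst p))"
    using dist by (intro sum_list_distinct_conv_sum_set) (simp add: distinct_map)
  also have "\<dots> = (\<Sum>p\<in>set es. f (fst p) (snd p)) + (\<Sum>p\<in>prod.swap ` set es. f (fst p) (snd p))"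
    by (simp add: sum.distrib sum.reindex)
  also have "\<dots> = (\<Sum>p\<in>oriented (graph_of n es). f (fst p) (snd p))"
    unfolding un using disj by (intro sum.union_disjoint[symmetric]) auto
  finally show ?thesis
    by (simp add: split_def)
qed

text \<open>Edges at \<open>a\<close> correspond to neighbours of \<open>a\<close>, and
  \<open>common\<close> leaves out the neighbour \<open>b\<close>; hence minus one.\<close>

lemma common_degree:
  assumes rep: "represents_graph n es" and ab: "{a, b} \<in> edges (graph_of n es)"
  shows "common (graph_of n es) a b True False = degree es a - 1"
proof -
  let ?E = "edges (graph_of n es)"
  note G = represents_graph_simple[OF rep]
  note D = simple_edgeD[OF G]
  have "{e \<in> ?E. a \<in> e} - {{a, b}} = (\<lambda>x. {a, x}) ` {x \<in> {..<n} - {a, b}. {a, x} \<in> ?E}"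
  proof (intro equalityI subsetI)
    fix e assume e: "e \<in> {e \<in> ?E. a \<in> e} - {{a, b}}"
    then have "card e = 2"
      using G by (simp add: simple_graph_def)
    then obtain p q where "e = {p, q}"
      by (auto simp: card_2_iff)
    then obtain x where x: "e = {a, x}"
      using e by auto
    then show "e \<in> (\<lambda>x. {a, x}) ` {x \<in> {..<n} - {a, b}. {a, x} \<in> ?E}"
      using e D[of a x] by auto
  qed (auto simp: doubleton_eq_iff)
  moreover have "inj_on (\<lambda>x. {a, x}) A" for A
    by (auto simp: inj_on_def doubleton_eq_iff)
  ultimately have "card ({e \<in> ?E. a \<in> e} - {{a, b}}) = common (graph_of n es) a b True False"
    by (simp add: common_def sat_def card_image)
  moreover have "card ({e \<in> ?E. a \<in> e} - {{a, b}}) = degree es a - 1"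
    using ab by (simp add: degree_def edges_graph_of card_Diff_singleton)
  ultimately show ?thesis by simp
qed

lemma common_verts:
  assumes rep: "represents_graph n es" and ab: "{a, b} \<in> edges (graph_of n es)"
  shows "common (graph_of n es) a b False False = n - 2"
proof -
  have "{x \<in> {..<n} - {a, b}. sat (edges (graph_of n es)) a b False False x} = {..<n} - {a, b}"
    by (auto simp: sat_def)
  then show ?thesis
    using simple_edgeD[OF represents_graph_simple[OF rep] ab]
    by (simp add: common_def card_Diff_subset)
qed

text \<open>A common neighbour \<open>y\<close> is met exactly once, at the oriented edge
  \<open>(a, y)\<close>, where one adjacency test with \<open>b\<close> recognises it.\<close>

lemma common_triangles:
  assumes rep: "represents_graph n es"
  shows "(\<Sum>(x, y)\<in>oriented (graph_of n es). of_bool (x = a \<and> {y, b} \<in> edges (graph_of n es))) =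
    common (graph_of n es) a b True True"
proof -
  let ?E = "edges (graph_of n es)"
  note D = simple_edgeD[OF represents_graph_simple[OF rep]]
  let ?T = "{x \<in> {..<n} - {a, b}. {a, x} \<in> ?E \<and> {b, x} \<in> ?E}"
  have "(\<Sum>(x, y)\<in>oriented (graph_of n es). of_bool (x = a \<and> {y, b} \<in> ?E)) = sum (\<lambda>_. 1) (Pair a ` ?T)"
  proof (rule sum.mono_neutral_cong_right)
    show "finite (oriented (graph_of n es))"
      by (rule finite_oriented[OF represents_graph_simple[OF rep]])
    show "Pair a ` ?T \<subseteq> oriented (graph_of n es)"
      by (auto simp: oriented_def)
    have "y \<in> ?T" if "{a, y} \<in> ?E" "{y, b} \<in> ?E" for y
      using D[OF that(1)] D[OF that(2)] that by (auto simp: insert_commute)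
    then show "\<forall>q\<in>oriented (graph_of n es) - Pair a ` ?T.
        (case q of (x, y) \<Rightarrow> of_bool (x = a \<and> {y, b} \<in> ?E)) = 0"
      by (auto simp: oriented_def)
    show "(case q of (x, y) \<Rightarrow> of_bool (x = a \<and> {y, b} \<in> ?E)) = 1" if "q \<in> Pair a ` ?T" for q
      using that by (auto simp: insert_commute)
  qed
  also have "\<dots> = card ?T"
    by (simp add: card_image inj_on_def)
  finally show ?thesis
    by (simp add: common_def sat_def)
qed

section \<open>Expressions for finite sums and counts\<close>

definition listing :: "'c set \<Rightarrow> 'c list" where
  "listing A = (SOME xs. set xs = A \<and> distinct xs)"

lemma listing: "finite A \<Longrightarrow> set (listing A) = A \<and> distinct (listing A)"
  unfolding listing_def by (rule someI_ex) (rule finite_distinct_list)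

text \<open>The index sets in use depend on the pattern only, so the unrolled sum has constant size
  and cost.\<close>

definition sum_exp :: "('c \<Rightarrow> aexp) \<Rightarrow> 'c set \<Rightarrow> aexp" where
  "sum_exp f A = foldr (\<lambda>i. Plus (f i)) (listing A) (Const 0)"

definition prod_exp :: "('c \<Rightarrow> aexp) \<Rightarrow> 'c set \<Rightarrow> aexp" where
  "prod_exp f A = foldr (\<lambda>i. Times (f i)) (listing A) (Const 1)"

lemma aval_sum_exp: "finite A \<Longrightarrow> aval n es \<sigma> (sum_exp f A) = (\<Sum>i\<in>A. aval n es \<sigma> (f i))"
proof -
  assume "finite A"
  have "aval n es \<sigma> (foldr (\<lambda>i. Plus (f i)) xs (Const 0)) = (\<Sum>i\<leftarrow>xs. aval n es \<sigma> (f i))" for xs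
    by (induction xs) auto
  then show ?thesis
    using listing[OF \<open>finite A\<close>] by (simp add: sum_exp_def sum_list_distinct_conv_sum_set)
qed

lemma aval_prod_exp: "finite A \<Longrightarrow> aval n es \<sigma> (prod_exp f A) = (\<Prod>i\<in>A. aval n es \<sigma> (f i))"
proof -
  assume "finite A"
  have "aval n es \<sigma> (foldr (\<lambda>i. Times (f i)) xs (Const 1)) = (\<Prod>i\<leftarrow>xs. aval n es \<sigma> (f i))" for xs
    by (induction xs) auto
  then show ?thesis
    using listing[OF \<open>finite A\<close>] prod.distinct_set_conv_list[of "listing A" "\<lambda>i. aval n es \<sigma> (f i)"]
    by (simp add: prod_exp_def)
qed

text \<open>The product of adjacency tests is 1 if all edges of a labelled pattern are present, and
  0 otherwise. \<open>Min\<close> and \<open>Max\<close> name the two ends of a labelled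
  edge.\<close>

definition ext_exp :: "'b ugraph \<Rightarrow> nat set set \<Rightarrow> aexp \<Rightarrow> aexp \<Rightarrow> aexp \<Rightarrow> aexp \<Rightarrow> aexp" where
  "ext_exp P R a b x y = sum_exp
    (prod_exp (\<lambda>e. Adj (quad a b x y (Min e)) (quad a b x y (Max e)))) {F \<in> labelings P. R \<subseteq> F}"

lemma aval_ext_exp [simp]:
  "aval n es \<sigma> (ext_exp P R a b x y) = extensions (edges (graph_of n es)) P R
    (aval n es \<sigma> a) (aval n es \<sigma> b) (aval n es \<sigma> x) (aval n es \<sigma> y)"
proof -
  let ?E = "edges (graph_of n es)"
  let ?q = "quad (aval n es \<sigma> a) (aval n es \<sigma> b) (aval n es \<sigma> x) (aval n es \<sigma> y)"
  let ?L = "{F \<in> labelings P. R \<subseteq> F}"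
  have q: "aval n es \<sigma> (quad a b x y i) = ?q i" for i
    by (simp add: quad_def)
  have e: "?q ` e = {?q (Min e), ?q (Max e)}" if "e \<in> K4" for e
    using that unfolding K4_eq by (elim insertE emptyE) (simp_all add: quad_def insert_commute)
  have "aval n es \<sigma> (prod_exp (\<lambda>e. Adj (quad a b x y (Min e)) (quad a b x y (Max e))) F) =
      of_bool ((`) ?q ` F \<subseteq> ?E)" if "F \<in> ?L" for F
  proof -
    have F: "F \<subseteq> K4"
      using that labelings_subset by blast
    then have fin: "finite F"
      using finite_K4 by (rule finite_subset)
    have "aval n es \<sigma> (prod_exp (\<lambda>e. Adj (quad a b x y (Min e)) (quad a b x y (Max e))) F) =
        (\<Prod>e\<in>F. of_bool (?q ` e \<in> ?E))"
      unfolding aval_prod_exp[OF fin] using F e by (intro prod.cong) (auto simp: q)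
    also have "\<dots> = of_bool (\<forall>e\<in>F. ?q ` e \<in> ?E)"
      using fin by (induction rule: finite_induct) auto
    finally show ?thesis by (simp add: image_subset_iff)
  qed
  then have "aval n es \<sigma> (ext_exp P R a b x y) = (\<Sum>F\<in>?L. of_bool ((`) ?q ` F \<subseteq> ?E))"
    by (simp add: ext_exp_def aval_sum_exp finite_labelings)
  also have "\<dots> = card {F \<in> ?L. (`) ?q ` F \<subseteq> ?E}"
    by (simp add: finite_labelings Int_def conj_assoc)
  finally show ?thesis
    by (simp add: extensions_def conj_assoc)
qed

text \<open>Equality tests give 0 or 1, so comparing their sum with 0 expresses that all four
  fail.\<close>

definition off_exp :: "aexp \<Rightarrow> aexp \<Rightarrow> aexp \<Rightarrow> aexp \<Rightarrow> aexp" where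
  "off_exp a b x y =
    Equal (Plus (Plus (Equal x a) (Equal x b)) (Plus (Equal y a) (Equal y b))) (Const 0)"

lemma aval_off_exp [simp]: "aval n es \<sigma> (off_exp a b x y) =
    of_bool (off (aval n es \<sigma> a) (aval n es \<sigma> b) (aval n es \<sigma> x) (aval n es \<sigma> y))"
  by (simp add: off_exp_def off_def)

definition sat_exp :: "aexp \<Rightarrow> aexp \<Rightarrow> bool \<Rightarrow> bool \<Rightarrow> aexp \<Rightarrow> aexp" where
  "sat_exp a b s t x = Times (if s then Adj a x else Const 1) (if t then Adj b x else Const 1)"

lemma aval_sat_exp [simp]: "aval n es \<sigma> (sat_exp a b s t x) =
    of_bool (sat (edges (graph_of n es)) (aval n es \<sigma> a) (aval n es \<sigma> b) s t (aval n es \<sigma> x))"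
  by (simp add: sat_exp_def sat_def)

text \<open>Register 3 holds the number of common neighbours.\<close>

definition common_exp :: "aexp \<Rightarrow> aexp \<Rightarrow> bool \<Rightarrow> bool \<Rightarrow> aexp" where
  "common_exp a b s t =
    (if s then if t then Reg 3 else Minus (Deg a) (Const 1)
     else if t then Minus (Deg b) (Const 1) else Minus NumV (Const 2))"

lemma aval_common_exp:
  assumes rep: "represents_graph n es"
    and ab: "{aval n es \<sigma> a, aval n es \<sigma> b} \<in> edges (graph_of n es)"
    and "regs \<sigma> 3 = common (graph_of n es) (aval n es \<sigma> a) (aval n es \<sigma> b) True True"
  shows "aval n es \<sigma> (common_exp a b s t) =
    common (graph_of n es) (aval n es \<sigma> a) (aval n es \<sigma> b) s t"
proof -
  have ba: "{aval n es \<sigma> b, aval n es \<sigma> a} \<in> edges (graph_of n es)"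
    using ab by (simp add: insert_commute)
  show ?thesis
    using assms(3) common_degree[OF rep ab] common_verts[OF rep ab] common_degree[OF rep ba]
    unfolding common_commute[of "graph_of n es" "aval n es \<sigma> b" "aval n es \<sigma> a" True False]
    by (cases s; cases t) (simp_all add: common_exp_def)
qed

definition spread_exp :: "'b ugraph \<Rightarrow> aexp \<Rightarrow> aexp \<Rightarrow> aexp" where
  "spread_exp P u v = sum_exp (\<lambda>F. Minus
     (Times (common_exp u v ({0, 2} \<in> F) ({1, 2} \<in> F)) (common_exp u v ({0, 3} \<in> F) ({1, 3} \<in> F)))
     (common_exp u v ({0, 2} \<in> F \<or> {0, 3} \<in> F) ({1, 2} \<in> F \<or> {1, 3} \<in> F)))
   {F \<in> labelings P. {0, 1} \<in> F \<and> {2, 3} \<notin> F}"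

lemma aval_spread_exp:
  assumes "represents_graph n es"
    and "{aval n es \<sigma> u, aval n es \<sigma> v} \<in> edges (graph_of n es)"
    and "regs \<sigma> 3 = common (graph_of n es) (aval n es \<sigma> u) (aval n es \<sigma> v) True True"
  shows "aval n es \<sigma> (spread_exp P u v) =
    spread_count (graph_of n es) P (aval n es \<sigma> u) (aval n es \<sigma> v)"
  by (simp add: spread_exp_def spread_count_def aval_sum_exp finite_labelings aval_common_exp[OF assms])

definition near_exp :: "'b ugraph \<Rightarrow> aexp \<Rightarrow> aexp \<Rightarrow> aexp \<Rightarrow> aexp" where
  "near_exp P a b x = sum_exp (\<lambda>F. Times (sat_exp a b ({0, 2} \<in> F) ({1, 2} \<in> F) x)
     (Minus (common_exp a b ({0, 3} \<in> F) ({1, 3} \<in> F)) (sat_exp a b ({0, 3} \<in> F) ({1, 3} \<in> F) x)))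
   {F \<in> labelings P. {0, 1} \<in> F \<and> {0, 2} \<in> F \<and> {2, 3} \<notin> F}"

lemma aval_near_exp:
  assumes "represents_graph n es"
    and "{aval n es \<sigma> a, aval n es \<sigma> b} \<in> edges (graph_of n es)"
    and "regs \<sigma> 3 = common (graph_of n es) (aval n es \<sigma> a) (aval n es \<sigma> b) True True"
  shows "aval n es \<sigma> (near_exp P a b x) =
    near_count (graph_of n es) P (aval n es \<sigma> a) (aval n es \<sigma> b) (aval n es \<sigma> x)"
  by (simp add: near_exp_def near_count_def aval_sum_exp finite_labelings aval_common_exp[OF assms])

section \<open>Programs\<close>

definition triangle_exp :: "aexp \<Rightarrow> aexp \<Rightarrow> aexp \<Rightarrow> aexp \<Rightarrow> aexp" where
  "triangle_exp u v x y = Times (Equal x u) (Adj y v)"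

text \<open>An array entry stands for two oriented edges, so both orders of \<open>x\<close> and
  \<open>y\<close> are evaluated.\<close>

definition count_body :: "'b ugraph \<Rightarrow> aexp \<Rightarrow> aexp \<Rightarrow> aexp \<Rightarrow> aexp \<Rightarrow> com" where
  "count_body P u v x y =
    Seq (Assign 3 (Plus (Reg 3) (Plus (triangle_exp u v x y) (triangle_exp u v y x))))
      (Assign 4 (Plus (Reg 4) (Times (off_exp u v x y)
        (Plus (ext_exp P {{0, 1}, {2, 3}} u v x y) (ext_exp P {{0, 1}, {2, 3}} u v y x)))))"

text \<open>
  Registers 0 and 1 hold the edge, 2 is the loop counter, 3 collects the number of common neighbours
  and 4 the result, which is doubled before the last step because \<open>x\<close> and \<open>y\<close> are ordered.
\<close>

definition count_prog :: "'b ugraph \<Rightarrow> com" where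
  "count_prog P =
    Seq (Assign 3 (Const 0)) (Seq (Assign 4 (Const 0))
      (Seq (For 2 (count_body P (Reg 0) (Reg 1) (End1 (Reg 2)) (End2 (Reg 2))))
        (Assign 4 (Div (Plus (Reg 4) (spread_exp P (Reg 0) (Reg 1))) (Const 2)))))"

lemma loop_depth_count_prog [simp]: "loop_depth (count_prog P) = 1"
  by (simp add: count_prog_def count_body_def)

text \<open>Replacing 2 by \<open>n + 2\<close> absorbs the constant into the power, and
  \<open>k > 0\<close> makes the inequality strict. This is the common check against
  overflow.\<close>

lemma word_bound:
  fixes n :: nat
  assumes "(n + 2) ^ 16 \<le> W" "0 < k" "k + j \<le> 16" "i \<le> 2 ^ j * n ^ k"
  shows "i < W"
proof -
  have "2 ^ j * n ^ k \<le> (n + 2) ^ j * n ^ k"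
    by (intro mult_le_mono power_mono) auto
  also have "\<dots> < (n + 2) ^ j * (n + 2) ^ k"
    using assms(2) by (intro mult_strict_left_mono power_strict_mono) auto
  also have "\<dots> \<le> (n + 2) ^ 16"
    using assms(3) by (simp add: add.commute power_increasing flip: power_add)
  finally show ?thesis
    using assms(1,4) by simp
qed

lemma nth_or_0_map: "i < length xs \<Longrightarrow> nth_or_0 (map f xs) i = f (xs ! i)"
  by (simp add: nth_or_0_def)

text \<open>The partial sums of the scan are monotone, so bounds on the final sums prevent overflow
  throughout. The postcondition mentions register 3 because \<open>delta_prog\<close> reads the
  number of common neighbours from it.\<close>

lemma wp_count_prog:
  assumes rep: "represents_graph n es" and P: "card (verts P) = 4" and W: "(n + 2) ^ 16 \<le> W"
    and uv: "{regs \<sigma> 0, regs \<sigma> 1} \<in> edges (graph_of n es)"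
    and S: "length (mem \<sigma>) \<le> S"
    and Q: "Q (\<sigma>\<lparr>regs := (regs \<sigma>)(2 := length es,
      3 := common (graph_of n es) (regs \<sigma> 0) (regs \<sigma> 1) True True,
      4 := subgraph_count_at (graph_of n es) P {regs \<sigma> 0, regs \<sigma> 1})\<rparr>)"
  shows "wp W n es S (count_prog P) Q \<sigma>"
proof -
  define G where "G = graph_of n es"
  define u v where "u = regs \<sigma> 0" and "v = regs \<sigma> 1"
  note G = represents_graph_simple[OF rep, folded G_def]
  define t where "t = (\<lambda>x y. of_bool (x = u \<and> {y, v} \<in> edges G) :: nat)"
  define h where "h = (\<lambda>x y. of_bool (off u v x y) * extensions (edges G) P {{0, 1}, {2, 3}} u v x y)"
  define T where "T = (\<lambda>k. \<Sum>i<k. t (fst (es ! i)) (snd (es ! i)) + t (snd (es ! i)) (fst (es ! i)))"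
  define H where "H = (\<lambda>k. \<Sum>i<k. h (fst (es ! i)) (snd (es ! i)) + h (snd (es ! i)) (fst (es ! i)))"
  have uv': "{u, v} \<in> edges G"
    using uv by (simp add: u_def v_def G_def)
  have T: "T (length es) = common G u v True True"
    unfolding T_def G_def by (subst sum_oriented[OF rep])
      (simp add: t_def G_def common_triangles[OF rep])
  have count: "2 * subgraph_count_at G P {u, v} = H (length es) + spread_count G P u v"
    using double_subgraph_count_at_eq[OF G P uv'] unfolding H_def sum_oriented[OF rep]
    by (simp add: h_def G_def)
  have cle: "2 * subgraph_count_at G P {u, v} \<le> 2 ^ 6 * n ^ 2"
    using subgraph_count_at_le[OF G P uv'] by (simp add: G_def)
  have "common G u v True True \<le> card {..<n}"
    unfolding common_def by (rule card_mono) (auto simp: G_def)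
  moreover have "T k \<le> T (length es)" if "k \<le> length es" for k
    unfolding T_def by (rule sum_mono2) (use that in auto)
  ultimately have Tless: "T k < W" if "k \<le> length es" for k
    using that T by (intro word_bound[OF W, of 1 0]) (auto intro: order_trans)
  have Hless: "H k < W" if "k \<le> length es" for k
  proof (rule word_bound[OF W, of 2 6])
    have "H k \<le> H (length es)"
      unfolding H_def by (rule sum_mono2) (use that in auto)
    then show "H k \<le> 2 ^ 6 * n ^ 2"
      using count cle by linarith
  qed auto
  have cless: "subgraph_count_at G P {u, v} < W"
    using cle by (intro word_bound[OF W, of 2 6]) auto
  have m: "length es < W"
    using length_le_square[OF rep] by (intro word_bound[OF W, of 2 0]) auto
  have "0 < W" using m by simp
  \<comment> \<open>The invariant is equality with this state, so the memory and all registers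
    except 2, 3 and 4 are known to be unchanged.\<close>
  define st where "st = (\<lambda>k. \<sigma>\<lparr>regs := (regs \<sigma>)(2 := k, 3 := T k, 4 := H k)\<rparr>)"
  have loop: "wp W n es S (For 2 (count_body P (Reg 0) (Reg 1) (End1 (Reg 2)) (End2 (Reg 2)))) Q' 
      (\<sigma>\<lparr>regs := (regs \<sigma>)(3 := 0, 4 := 0)\<rparr>)" if Q': "Q' (st (length es))" for Q'
  proof (rule wp_For[where I = "\<lambda>k \<sigma>'. \<sigma>' = st k"])
    show "set_reg 2 0 (\<sigma>\<lparr>regs := (regs \<sigma>)(3 := 0, 4 := 0)\<rparr>) = st 0"
      by (simp add: set_reg_def st_def T_def H_def fun_upd_twist)
  next
    fix k \<sigma>' assume k: "k < length es" and \<sigma>': "\<sigma>' = st k"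
    obtain x y where xy: "es ! k = (x, y)" by force
    have sim: "regs (st k) 0 = u" "regs (st k) (Suc 0) = v" "regs (st k) 2 = k" "regs (st k) 3 = T k"
      "regs (st k) 4 = H k" "mem (st k) = mem \<sigma>"
      by (simp_all add: st_def u_def v_def)
    have T': "T (Suc k) = T k + (t x y + t y x)" and H': "H (Suc k) = H k + (h x y + h y x)"
      by (simp_all add: T_def H_def xy)
    have off: "off u v y x = off u v x y"
      by (auto simp: off_def)
    let ?T = "Plus (Reg 3) (Plus
      (triangle_exp (Reg 0) (Reg 1) (End1 (Reg 2)) (End2 (Reg 2)))
      (triangle_exp (Reg 0) (Reg 1) (End2 (Reg 2)) (End1 (Reg 2))))"
    let ?H = "Plus (Reg 4) (Times (off_exp (Reg 0) (Reg 1) (End1 (Reg 2)) (End2 (Reg 2)))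
      (Plus (ext_exp P {{0, 1}, {2, 3}} (Reg 0) (Reg 1) (End1 (Reg 2)) (End2 (Reg 2)))
       (ext_exp P {{0, 1}, {2, 3}} (Reg 0) (Reg 1) (End2 (Reg 2)) (End1 (Reg 2)))))"
    have T3: "aval n es (st k) ?T = T (Suc k)"
      using k by (simp add: sim triangle_exp_def nth_or_0_map xy T' t_def G_def of_bool_conj)
    have H4: "aval n es (set_reg 3 (T (Suc k)) (st k)) ?H = H (Suc k)"
      using k by (simp add: sim nth_or_0_map xy H' h_def G_def off algebra_simps)
    have "set_reg 2 (Suc k) (set_reg 4 (H (Suc k)) (set_reg 3 (T (Suc k)) (st k))) = st (Suc k)"
      by (simp add: set_reg_def st_def fun_upd_twist)
    then have "wp W n es S (Assign 4 ?H)
      (\<lambda>\<sigma>'. regs \<sigma>' 2 = k \<and> length (mem \<sigma>') \<le> S \<and> set_reg 2 (Suc k) \<sigma>' = st (Suc k))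
      (set_reg 3 (T (Suc k)) (st k))"
      using Hless[of "Suc k"] k S by (intro wp_Assign; (unfold H4)?) (simp_all add: sim)
    then show "wp W n es S (count_body P (Reg 0) (Reg 1) (End1 (Reg 2)) (End2 (Reg 2)))
      (\<lambda>\<sigma>'. regs \<sigma>' 2 = k \<and> length (mem \<sigma>') \<le> S \<and> set_reg 2 (Suc k) \<sigma>' = st (Suc k)) \<sigma>'"
      unfolding \<sigma>' count_body_def using Tless[of "Suc k"] k S
      by (intro wp_Seq wp_Assign[where a = ?T]; (unfold T3)?) (simp_all only: Suc_leI sim)
  qed (use m S Q' in auto)
  \<comment> \<open>By \<open>count\<close> the dividend is twice the count, so the division is
    exact.\<close>
  have final: "aval n es (st (length es)) (Div (Plus (Reg 4) (spread_exp P (Reg 0) (Reg 1))) (Const 2))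
      = subgraph_count_at G P {u, v}"
  proof -
    have "aval n es (st (length es)) (spread_exp P (Reg 0) (Reg 1)) = spread_count G P u v"
      using T uv' by (subst aval_spread_exp[OF rep]) (simp_all add: st_def u_def v_def G_def)
    then show ?thesis
      using count by (simp add: st_def)
  qed
  have "wp W n es S (Assign 4 (Div (Plus (Reg 4) (spread_exp P (Reg 0) (Reg 1))) (Const 2))) Q
      (st (length es))"
  proof (rule wp_Assign; (unfold final)?)
    show "Q (set_reg 4 (subgraph_count_at G P {u, v}) (st (length es)))"
      using Q[folded u_def v_def G_def] by (simp add: set_reg_def st_def T)
  qed (use cless S in \<open>simp_all add: st_def\<close>)
  then have "wp W n es S (For 2 (count_body P (Reg 0) (Reg 1) (End1 (Reg 2)) (End2 (Reg 2))))
      (wp W n es S (Assign 4 (Div (Plus (Reg 4) (spread_exp P (Reg 0) (Reg 1))) (Const 2))) Q)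
      (\<sigma>\<lparr>regs := (regs \<sigma>)(3 := 0, 4 := 0)\<rparr>)"
    by (rule loop)
  then show ?thesis
    unfolding count_prog_def using \<open>0 < W\<close> S
    by (intro wp_Seq wp_Assign) (simp_all add: set_reg_def)
qed

section \<open>Changing the counters of all edges\<close>

text \<open>\<open>True\<close> stands for insertion and \<open>False\<close> for deletion, so that
  both share one program and one proof.\<close>

definition acc :: "bool \<Rightarrow> nat \<Rightarrow> nat \<Rightarrow> nat" where
  "acc b c d = (if b then c + d else c - d)"

text \<open>This holds for truncated subtraction too, so deletions need no lower bounds on the counters.\<close>

lemma acc_acc: "acc b (acc b c d) d' = acc b c (d + d')"
  by (simp add: acc_def)

lemma acc_0 [simp]: "acc b c 0 = c"
  by (simp add: acc_def)

type_synonym bump = "aexp \<times> aexp \<times> aexp"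

text \<open>A triple \<open>(g, k, v)\<close> changes cell \<open>k\<close> by \<open>v\<close> if \<open>g\<close> is nonzero.\<close>

fun bumps :: "bool \<Rightarrow> bump list \<Rightarrow> com" where
  "bumps b [] = Skip"
| "bumps b ((g, k, v) # us) =
    Seq (If g (Store k (if b then Plus (Mem k) v else Minus (Mem k) v)) Skip) (bumps b us)"

lemma loop_depth_bumps [simp]: "loop_depth (bumps b us) = 0"
  by (induction b us rule: bumps.induct) auto

text \<open>Several triples may hit the same cell, so their values are added; all are evaluated in
  the one state \<open>\<sigma>\<close>.\<close>

fun bump_total :: "nat \<Rightarrow> edge_array \<Rightarrow> machine \<Rightarrow> bump list \<Rightarrow> nat \<Rightarrow> nat" where
  "bump_total n es \<sigma> [] j = 0"
| "bump_total n es \<sigma> ((g, k, v) # us) j =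
    (if aval n es \<sigma> g \<noteq> 0 \<and> aval n es \<sigma> k = j then aval n es \<sigma> v else 0) + bump_total n es \<sigma> us j"

lemma bump_total_append:
  "bump_total n es \<sigma> (us @ vs) j = bump_total n es \<sigma> us j + bump_total n es \<sigma> vs j"
  by (induction us) auto

text \<open>A condition on values rather than syntax, which suits expressions built by folds.
  Changing one counter then cannot disturb the later triples.\<close>

definition mem_free :: "aexp \<Rightarrow> bool" where
  "mem_free a \<longleftrightarrow> (\<forall>n es \<sigma> xs. aval n es (\<sigma>\<lparr>mem := xs\<rparr>) a = aval n es \<sigma> a)"

lemma mem_freeD [simp]: "mem_free a \<Longrightarrow> aval n es (\<sigma>\<lparr>mem := xs\<rparr>) a = aval n es \<sigma> a"
  by (simp add: mem_free_def)

lemma bump_total_mem_free: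
  "\<forall>(g, k, v)\<in>set us. mem_free g \<and> mem_free k \<and> mem_free v \<Longrightarrow>
    bump_total n es (\<sigma>\<lparr>mem := xs\<rparr>) us j = bump_total n es \<sigma> us j"
  by (induction us) auto

text \<open>A program step reads no memory except the cell it changes, so all triples may be
  evaluated in the initial state. Increments are safe if the final values fit into words, decrements
  if the initial ones do.\<close>

lemma wp_bumps:
  assumes "\<forall>(g, k, v)\<in>set us. mem_free g \<and> mem_free k \<and> mem_free v"
    and "\<forall>(g, k, v)\<in>set us. aval n es \<sigma> g \<noteq> 0 \<longrightarrow> aval n es \<sigma> k < length (mem \<sigma>)"
    and "\<forall>j<length (mem \<sigma>). mem \<sigma> ! j < W \<and> (b \<longrightarrow> mem \<sigma> ! j + bump_total n es \<sigma> us j < W)"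
    and "length (mem \<sigma>) \<le> S"
    and "Q (\<sigma>\<lparr>mem := map (\<lambda>j. acc b (mem \<sigma> ! j) (bump_total n es \<sigma> us j)) [0..<length (mem \<sigma>)]\<rparr>)"
  shows "wp W n es S (bumps b us) Q \<sigma>"
  using assms
proof (induction b us arbitrary: \<sigma> rule: bumps.induct)
  case (1 b)
  then show ?case
    by (auto intro!: wp_Skip simp: map_nth)
next
  case (2 b g k v us)
  note free = 2(2) and idx = 2(3) and bound = 2(4) and S = 2(5) and Q = 2(6)
  have fus: "\<forall>(g, k, v)\<in>set us. mem_free g \<and> mem_free k \<and> mem_free v"
    and fg: "mem_free g" "mem_free k" "mem_free v"
    using free by auto
  let ?k = "aval n es \<sigma> k" and ?v = "aval n es \<sigma> v"
  show ?case
    unfolding bumps.simps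
  proof (intro wp_Seq wp_If)
    assume g: "aval n es \<sigma> g \<noteq> 0"
    have k: "?k < length (mem \<sigma>)" using idx g by auto
    let ?e = "if b then Plus (Mem k) v else Minus (Mem k) v"
    have e: "aval n es \<sigma> ?e = acc b (mem \<sigma> ! ?k) ?v"
      using k by (simp add: acc_def nth_or_0_def)
    let ?\<sigma> = "\<sigma>\<lparr>mem := (mem \<sigma>)[?k := acc b (mem \<sigma> ! ?k) ?v]\<rparr>"
    have tot: "bump_total n es ?\<sigma> us j = bump_total n es \<sigma> us j" for j
      using bump_total_mem_free[OF fus] .
    show "wp W n es S (Store k ?e) (wp W n es S (bumps b us) Q) \<sigma>"
    proof (rule wp_Store)
      show "aval n es \<sigma> ?e < W"
        unfolding e using bound k g by (fastforce simp: acc_def)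
      show "wp W n es S (bumps b us) Q (\<sigma>\<lparr>mem := (mem \<sigma>)[?k := aval n es \<sigma> ?e]\<rparr>)"
        unfolding e
      proof (rule "2.IH")
        show "\<forall>(g, k, v)\<in>set us. aval n es ?\<sigma> g \<noteq> 0 \<longrightarrow> aval n es ?\<sigma> k < length (mem ?\<sigma>)"
          using idx free by fastforce
        show "\<forall>j<length (mem ?\<sigma>). mem ?\<sigma> ! j < W \<and> (b \<longrightarrow> mem ?\<sigma> ! j + bump_total n es ?\<sigma> us j < W)"
          using bound g k unfolding tot by (fastforce simp: nth_list_update acc_def)
        have eq: "map (\<lambda>j. acc b (mem ?\<sigma> ! j) (bump_total n es ?\<sigma> us j)) [0..<length (mem ?\<sigma>)] =
          map (\<lambda>j. acc b (mem \<sigma> ! j) (bump_total n es \<sigma> ((g, k, v) # us) j)) [0..<length (mem \<sigma>)]"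
          using g k unfolding tot by (auto simp: nth_list_update acc_acc)
        show "Q (?\<sigma>\<lparr>mem := map (\<lambda>j. acc b (mem ?\<sigma> ! j) (bump_total n es ?\<sigma> us j)) [0..<length (mem ?\<sigma>)]\<rparr>)"
          unfolding eq using Q by simp
      qed (use fus S in auto)
    qed (use k S in auto)
  next
    assume g: "aval n es \<sigma> g = 0"
    then have "wp W n es S (bumps b us) Q \<sigma>"
      using fus idx bound S Q by (intro "2.IH") auto
    then show "wp W n es S Skip (wp W n es S (bumps b us) Q) \<sigma>"
      using S by (intro wp_Skip)
  qed
qed

text \<open>The triples are the two summands of \<open>scatter_term\<close>. The first looks up the
  cell of \<open>cp\<close>, guarded by adjacency because \<open>Pos\<close> of a nonedge lies
  outside the array; the second addresses the scanned entry through register 2.\<close>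

definition edge_bumps :: "'b ugraph \<Rightarrow> aexp \<Rightarrow> aexp \<Rightarrow> aexp \<Rightarrow> aexp \<Rightarrow> bump list" where
  "edge_bumps P c d p q =
    [(Times (off_exp c d p q) (Adj c p), Pos c p, ext_exp P {{0, 1}, {0, 2}, {2, 3}} c d p q),
     (Times (Equal p c) (Equal (Equal q d) (Const 0)), Reg 2, near_exp P c d q)]"

text \<open>The first triple serves the scanned entry if it is disjoint from \<open>ab\<close>; the
  other four groups serve edges at \<open>a\<close> and at \<open>b\<close>, with the entry read in
  both directions.\<close>

definition delta_bumps :: "'b ugraph \<Rightarrow> aexp \<Rightarrow> aexp \<Rightarrow> aexp \<Rightarrow> aexp \<Rightarrow> bump list" where
  "delta_bumps P a b x y = (off_exp a b x y, Reg 2, ext_exp P {{0, 1}, {2, 3}} a b x y) #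
    edge_bumps P a b x y @ edge_bumps P a b y x @ edge_bumps P b a x y @ edge_bumps P b a y x"

definition delta_prog :: "bool \<Rightarrow> 'b ugraph \<Rightarrow> com" where
  "delta_prog s P = For 2 (bumps s (delta_bumps P (Reg 0) (Reg 1) (End1 (Reg 2)) (End2 (Reg 2))))"

lemma loop_depth_delta_prog [simp]: "loop_depth (delta_prog s P) = 1"
  by (simp add: delta_prog_def)

lemma mem_free_intros:
  "mem_free (Reg r)" "mem_free (Const c)" "mem_free NumV" "mem_free a \<Longrightarrow> mem_free (End1 a)" "mem_free a \<Longrightarrow> mem_free (End2 a)"
  "mem_free a \<Longrightarrow> mem_free (Deg a)"
  "mem_free a \<Longrightarrow> mem_free b \<Longrightarrow> mem_free (Adj a b)"
  "mem_free a \<Longrightarrow> mem_free b \<Longrightarrow> mem_free (Pos a b)"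
  "mem_free a \<Longrightarrow> mem_free b \<Longrightarrow> mem_free (Times a b)"
  "mem_free a \<Longrightarrow> mem_free b \<Longrightarrow> mem_free (Minus a b)"
  "mem_free a \<Longrightarrow> mem_free b \<Longrightarrow> mem_free (Equal a b)"
  by (simp_all add: mem_free_def)

lemma mem_free_compound:
  assumes "mem_free a" "mem_free b" "mem_free x"
  shows "mem_free y \<Longrightarrow> mem_free (ext_exp P R a b x y)" "mem_free y \<Longrightarrow> mem_free (off_exp a b x y)"
    "mem_free (near_exp P a b x)"
proof -
  have "mem_free (common_exp a b s t)" "mem_free (sat_exp a b s t x)" for s t
    using assms by (simp_all add: common_exp_def sat_exp_def mem_free_intros)
  then show "mem_free (near_exp P a b x)"
    by (simp add: mem_free_def near_exp_def aval_sum_exp finite_labelings)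
qed (use assms in \<open>simp_all add: mem_free_def\<close>)

lemma delta_bumps_mem_free:
  assumes "mem_free a" "mem_free b" "mem_free x" "mem_free y"
  shows "\<forall>(g, k, v)\<in>set (delta_bumps P a b x y). mem_free g \<and> mem_free k \<and> mem_free v"
  using assms
  by (auto simp: delta_bumps_def edge_bumps_def intro!: mem_free_intros mem_free_compound)

text \<open>Distinctness of the entries turns the comparison of addresses with \<open>j\<close> into
  a comparison of edges.\<close>

lemma bump_total_edge_bumps:
  assumes rep: "represents_graph n es" and j: "j < length es" and i: "i < length es"
    and reg2: "regs \<sigma> 2 = i"
    and cd: "{aval n es \<sigma> c, aval n es \<sigma> d} \<in> edges (graph_of n es)"
    and reg3: "regs \<sigma> 3 = common (graph_of n es) (aval n es \<sigma> c) (aval n es \<sigma> d) True True"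
    and pq: "uedge (es ! i) = {aval n es \<sigma> p, aval n es \<sigma> q}"
  shows "bump_total n es \<sigma> (edge_bumps P c d p q) j =
    scatter_term (graph_of n es) P (aval n es \<sigma> c) (aval n es \<sigma> d) (uedge (es ! j))
      (aval n es \<sigma> p) (aval n es \<sigma> q)"
proof -
  have "uedge (es ! j) \<in> edges (graph_of n es)"
    using j by (simp add: edges_graph_of)
  then have "{aval n es \<sigma> c, aval n es \<sigma> p} \<in> edges (graph_of n es) \<and>
      edge_pos es (aval n es \<sigma> c) (aval n es \<sigma> p) = j \<longleftrightarrow>
    uedge (es ! j) = {aval n es \<sigma> c, aval n es \<sigma> p}"
    using edge_pos_eq_iff[OF rep _ j] by metis
  moreover have "i = j \<longleftrightarrow> uedge (es ! j) = {aval n es \<sigma> p, aval n es \<sigma> q}"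
    using uedge_eq_iff[OF rep i j] pq by auto
  ultimately show ?thesis
    by (auto simp: edge_bumps_def scatter_term_def reg2 aval_near_exp[OF rep cd reg3])
qed

lemma bump_total_delta_bumps:
  assumes rep: "represents_graph n es" and j: "j < length es" and i: "i < length es"
    and reg2: "regs \<sigma> 2 = i"
    and G: "G = graph_of n es" and ab: "{aval n es \<sigma> a, aval n es \<sigma> b} \<in> edges G"
    and reg3: "regs \<sigma> 3 = common G (aval n es \<sigma> a) (aval n es \<sigma> b) True True"
    and xy: "es ! i = (aval n es \<sigma> x, aval n es \<sigma> y)"
    and st: "st = (\<lambda>c d p q. scatter_term G P (aval n es \<sigma> c) (aval n es \<sigma> d) (uedge (es ! j))
      (aval n es \<sigma> p) (aval n es \<sigma> q))"
  shows "bump_total n es \<sigma> (delta_bumps P a b x y) j =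
    (if i = j then of_bool (off (aval n es \<sigma> a) (aval n es \<sigma> b) (aval n es \<sigma> x) (aval n es \<sigma> y)) *
      extensions (edges G) P {{0, 1}, {2, 3}}
        (aval n es \<sigma> a) (aval n es \<sigma> b) (aval n es \<sigma> x) (aval n es \<sigma> y) else 0) +
    ((st a b x y + st a b y x) + (st b a x y + st b a y x))"
proof -
  note eb = bump_total_edge_bumps[OF rep j i reg2, folded G]
  have ba: "{aval n es \<sigma> b, aval n es \<sigma> a} \<in> edges G"
    using ab by (simp add: insert_commute)
  have reg3': "regs \<sigma> 3 = common G (aval n es \<sigma> b) (aval n es \<sigma> a) True True"
    using reg3 common_commute by metis
  have "uedge (es ! i) = {aval n es \<sigma> x, aval n es \<sigma> y}"
    "uedge (es ! i) = {aval n es \<sigma> y, aval n es \<sigma> x}"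
    by (auto simp: xy uedge_def)
  then show ?thesis
    by (simp add: delta_bumps_def bump_total_append eb[OF ab reg3] eb[OF ba reg3'] reg2 st G)
qed

text \<open>Summed over all entries, the contributions become \<open>scatter\<close> sums, which
  \<open>joint_count_eq_scatter\<close> evaluates. Partial sums stay below the final change, so word
  bounds on the initial and final counters suffice.\<close>

lemma wp_delta_prog:
  assumes rep: "represents_graph n es" and P: "card (verts P) = 4" and m: "length es < W"
    and ab: "{regs \<sigma> 0, regs \<sigma> 1} \<in> edges (graph_of n es)"
    and reg3: "regs \<sigma> 3 = common (graph_of n es) (regs \<sigma> 0) (regs \<sigma> 1) True True"
    and len: "length (mem \<sigma>) = length es" and S: "length es \<le> S"
    and D: "D = (\<lambda>e. if e = {regs \<sigma> 0, regs \<sigma> 1} then 0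
      else joint_count (graph_of n es) P e {regs \<sigma> 0, regs \<sigma> 1})"
    and bound: "\<And>j. j < length es \<Longrightarrow> mem \<sigma> ! j < W \<and> (s \<longrightarrow> mem \<sigma> ! j + D (uedge (es ! j)) < W)"
    and Q: "Q (\<sigma>\<lparr>regs := (regs \<sigma>)(2 := length es),
      mem := map (\<lambda>j. acc s (mem \<sigma> ! j) (D (uedge (es ! j)))) [0..<length es]\<rparr>)"
  shows "wp W n es S (delta_prog s P) Q \<sigma>"
proof -
  define G where "G = graph_of n es"
  define a b where "a = regs \<sigma> 0" and "b = regs \<sigma> 1"
  note G = represents_graph_simple[OF rep, folded G_def]
  have ab': "{a, b} \<in> edges G"
    using ab by (simp add: a_def b_def G_def)
  have D': "D = (\<lambda>e. if e = {a, b} then 0 else joint_count G P e {a, b})"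
    unfolding D a_def b_def G_def ..
  let ?st = "scatter_term G P"
  \<comment> \<open>What entry \<open>i\<close> contributes to cell \<open>j\<close>.\<close>
  define \<delta> where "\<delta> = (\<lambda>i j. let x = fst (es ! i); y = snd (es ! i); e = uedge (es ! j) in
    (if i = j then of_bool (off a b x y) * extensions (edges G) P {{0, 1}, {2, 3}} a b x y else 0) +
    ((?st a b e x y + ?st a b e y x) + (?st b a e x y + ?st b a e y x)))"
  have \<delta>: "(\<Sum>i<length es. \<delta> i j) = D (uedge (es ! j))" if j: "j < length es" for j
  proof -
    obtain x y where xy: "es ! j = (x, y)" by force
    have e: "uedge (es ! j) = {x, y}" by (simp add: xy uedge_def)
    have "(\<Sum>i<length es. \<delta> i j) =
      of_bool (off a b x y) * extensions (edges G) P {{0, 1}, {2, 3}} a b x y +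
      (scatter G P a b {x, y} + scatter G P b a {x, y})"
      unfolding \<delta>_def Let_def sum.distrib[of "\<lambda>i. if i = j then _ i else 0"]
        sum.distrib[of "\<lambda>i. ?st a b _ _ _ + _ i"] scatter_def G_def sum_oriented[OF rep, symmetric] e
      using j xy by (simp add: sum.distrib)
    also have "\<dots> = D {x, y}"
      using joint_count_eq_scatter[OF G P ab' represents_graph_nth(4)[OF rep j xy, folded G_def]]
      by (simp only: D' add.assoc)
    finally show ?thesis by (simp add: e)
  qed
  define \<Delta> where "\<Delta> = (\<lambda>k j. \<Sum>i<k. \<delta> i j)"
  have \<Delta>_le: "\<Delta> k j \<le> D (uedge (es ! j))" if "k \<le> length es" "j < length es" for k j
    unfolding \<delta>[OF that(2), symmetric] \<Delta>_def by (rule sum_mono2) (use that in auto)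
  define st where "st = (\<lambda>k. \<sigma>\<lparr>regs := (regs \<sigma>)(2 := k),
    mem := map (\<lambda>j. acc s (mem \<sigma> ! j) (\<Delta> k j)) [0..<length es]\<rparr>)"
  show ?thesis
    unfolding delta_prog_def
  proof (rule wp_For[where I = "\<lambda>k \<sigma>'. \<sigma>' = st k"])
    have "map ((!) (mem \<sigma>)) [0..<length es] = mem \<sigma>"
      using map_nth[of "mem \<sigma>"] len by simp
    then show "set_reg 2 0 \<sigma> = st 0"
      by (simp add: set_reg_def st_def \<Delta>_def)
    show "Q \<sigma>'" if "\<sigma>' = st (length es)" for \<sigma>'
    proof -
      have eq: "map (\<lambda>j. acc s (mem \<sigma> ! j) (\<Delta> (length es) j)) [0..<length es] =
        map (\<lambda>j. acc s (mem \<sigma> ! j) (D (uedge (es ! j)))) [0..<length es]"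
        by (simp add: \<Delta>_def \<delta>)
      show ?thesis
        unfolding that st_def eq by (fact Q)
    qed
  next
    fix k \<sigma>' assume k: "k < length es" and \<sigma>': "\<sigma>' = st k"
    obtain x y where xy: "es ! k = (x, y)" by force
    have sim: "regs (st k) 0 = a" "regs (st k) (Suc 0) = b" "regs (st k) 2 = k"
      "regs (st k) 3 = common G a b True True" "length (mem (st k)) = length es"
      using reg3 by (simp_all add: st_def a_def b_def G_def)
    let ?us = "delta_bumps P (Reg 0) (Reg 1) (End1 (Reg 2)) (End2 (Reg 2))"
    have avs: "aval n es (st k) (Reg 0) = a" "aval n es (st k) (Reg 1) = b"
      "aval n es (st k) (End1 (Reg 2)) = x" "aval n es (st k) (End2 (Reg 2)) = y"
      using k by (simp_all add: sim nth_or_0_map xy)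
    have total: "bump_total n es (st k) ?us j = \<delta> k j" if j: "j < length es" for j
      using bump_total_delta_bumps[OF rep j k sim(3) G_def, of "Reg 0" "Reg 1" "End1 (Reg 2)"
          "End2 (Reg 2)" _ P, unfolded avs, OF ab' sim(4) xy refl]
      by (simp only: \<delta>_def Let_def xy fst_conv snd_conv avs)
    show "wp W n es S (bumps s ?us)
      (\<lambda>\<sigma>'. regs \<sigma>' 2 = k \<and> length (mem \<sigma>') \<le> S \<and> set_reg 2 (Suc k) \<sigma>' = st (Suc k)) \<sigma>'"
      unfolding \<sigma>'
    proof (rule wp_bumps)
      show "\<forall>(g, c, v)\<in>set ?us. mem_free g \<and> mem_free c \<and> mem_free v"
        by (intro delta_bumps_mem_free mem_free_intros)
      show "\<forall>(g, c, v)\<in>set ?us. aval n es (st k) g \<noteq> 0 \<longrightarrow> aval n es (st k) c < length (mem (st k))"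
        using k edge_pos(1)[of _ _ n es] by (auto simp: delta_bumps_def edge_bumps_def sim)
      show "\<forall>j<length (mem (st k)). mem (st k) ! j < W \<and>
          (s \<longrightarrow> mem (st k) ! j + bump_total n es (st k) ?us j < W)"
      proof (intro allI impI)
        fix j assume "j < length (mem (st k))"
        then have j: "j < length es" by (simp add: sim)
        have "mem (st k) ! j = acc s (mem \<sigma> ! j) (\<Delta> k j)"
          using j by (simp add: st_def)
        moreover have "\<Delta> k j + \<delta> k j = \<Delta> (Suc k) j"
          by (simp add: \<Delta>_def)
        ultimately show "mem (st k) ! j < W \<and> (s \<longrightarrow> mem (st k) ! j + bump_total n es (st k) ?us j < W)"
          unfolding total[OF j] using \<Delta>_le[of "Suc k" j] k j bound[OF j] by (auto simp: acc_def)
      qed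
      have eq: "map (\<lambda>j. acc s (mem (st k) ! j) (bump_total n es (st k) ?us j)) [0..<length (mem (st k))] =
        map (\<lambda>j. acc s (mem \<sigma> ! j) (\<Delta> (Suc k) j)) [0..<length es]"
        unfolding sim
      proof (rule map_cong[OF refl])
        fix j assume "j \<in> set [0..<length es]"
        then have j: "j < length es" by simp
        show "acc s (mem (st k) ! j) (bump_total n es (st k) ?us j) = acc s (mem \<sigma> ! j) (\<Delta> (Suc k) j)"
          unfolding total[OF j] using j by (simp add: acc_acc st_def \<Delta>_def)
      qed
      let ?\<sigma> = "st k\<lparr>mem := map (\<lambda>j. acc s (mem (st k) ! j) (bump_total n es (st k) ?us j))
        [0..<length (mem (st k))]\<rparr>"
      show "regs ?\<sigma> 2 = k \<and> length (mem ?\<sigma>) \<le> S \<and> set_reg 2 (Suc k) ?\<sigma> = st (Suc k)"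
        unfolding eq using S by (simp add: sim) (simp add: set_reg_def st_def)
    qed (use S sim in simp)
  qed (use m S len in auto)
qed

section \<open>Dynamic algorithms\<close>

lemma graph_of_insert_edge:
  "graph_of n (insert_edge u v es) = ({..<n}, insert {u, v} (edges (graph_of n es)))"
  by (simp add: graph_of_def insert_edge_def uedge_def)

lemma represents_graph_insert_edge:
  "represents_graph n es \<Longrightarrow> u < n \<Longrightarrow> v < n \<Longrightarrow> u \<noteq> v \<Longrightarrow> {u, v} \<notin> edges (graph_of n es) \<Longrightarrow>
    represents_graph n (insert_edge u v es)"
  by (auto simp: represents_graph_def insert_edge_def edges_graph_of uedge_def)

lemma delete_edge_cases:
  assumes "{u, v} \<in> edges (graph_of n es)"
  obtains xs e where "es = xs @ [e]" "uedge e = {u, v}" "delete_edge u v es = xs"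
  | xs e zs l where "es = xs @ e # zs @ [l]" "uedge e = {u, v}" "delete_edge u v es = xs @ l # zs"
proof -
  let ?k = "edge_pos es u v"
  note k = edge_pos[OF assms]
  have es: "es = take ?k es @ es ! ?k # drop (Suc ?k) es"
    using k(1) by (rule id_take_nth_drop)
  define xs where "xs = take ?k es"
  have len: "?k = length xs"
    using k(1) by (simp add: xs_def)
  show thesis
  proof (cases "drop (Suc ?k) es" rule: rev_cases)
    case Nil
    then have "es = xs @ [es ! ?k]"
      using es by (simp add: xs_def)
    \<comment> \<open>Here the position equals the length of \<open>butlast es\<close>, so the list
      update has no effect.\<close>
    then have "delete_edge u v es = xs"
      unfolding delete_edge_def len by (metis butlast_snoc list_update_beyond order_refl)
    then show thesis
      using that(1) \<open>es = xs @ [es ! ?k]\<close> k(2) by blast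
  next
    case (snoc zs l)
    then have eq: "es = xs @ es ! ?k # zs @ [l]"
      using es by (simp add: xs_def)
    have "butlast es = xs @ es ! ?k # zs" "last es = l"
      by (subst eq, simp add: butlast_append)+
    then have "delete_edge u v es = xs @ l # zs"
      unfolding delete_edge_def len by simp
    then show thesis
      using that(2) eq k(2) by blast
  qed
qed

text \<open>The last claim presents the old graph as the new one with an edge inserted, so that the
  insertion lemmas also govern deletions.\<close>

lemma delete_edge:
  assumes rep: "represents_graph n es" and uv: "{u, v} \<in> edges (graph_of n es)"
  shows "represents_graph n (delete_edge u v es)"
    and "length es = Suc (length (delete_edge u v es))"
    and "{u, v} \<notin> edges (graph_of n (delete_edge u v es))"
    and "graph_of n es = ({..<n}, insert {u, v} (edges (graph_of n (delete_edge u v es))))"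
  using uv
  by (cases rule: delete_edge_cases; use rep in \<open>auto simp: represents_graph_def graph_of_def\<close>)+

section \<open>From programs to dynamic algorithms\<close>

text \<open>Insertions work on the new graph and deletions on the old one, so in both cases the
  updated edge is present while the copies through it are counted.\<close>

definition alg :: "com \<Rightarrow> com \<Rightarrow> com \<Rightarrow> com \<Rightarrow> dyn_alg" where
  "alg i a d q = \<lparr>init_prog = i, ins_before = Skip, ins_after = a, del_before = d, del_after = Skip,
    query_prog = q\<rparr>"

lemma alg_simps [simp]:
  "init_prog (alg i a d q) = i" "ins_before (alg i a d q) = Skip" "ins_after (alg i a d q) = a"
  "del_before (alg i a d q) = d" "del_after (alg i a d q) = Skip" "query_prog (alg i a d q) = q"
  by (simp_all add: alg_def)

lemma wp_run: "wp W n es S c Q \<sigma> \<Longrightarrow> run W n es c \<sigma> t s \<sigma>' \<Longrightarrow> Q \<sigma>'"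
  unfolding wp_def using run_deterministic by metis

lemma load_simps [simp]:
  "mem (load xs \<sigma>) = mem \<sigma>"
  "regs (load xs \<sigma>) r = (if r < length xs then xs ! r else regs \<sigma> r)"
  by (simp_all add: load_def)

definition edge_regs :: "nat \<Rightarrow> nat \<Rightarrow> machine \<Rightarrow> bool" where
  "edge_regs u v \<sigma> \<longleftrightarrow> regs \<sigma> 0 = u \<and> regs \<sigma> 1 = v"

lemma edge_regs_load [simp]: "edge_regs u v (load [u, v] \<sigma>)"
  by (simp add: edge_regs_def)

text \<open>The invariant \<open>I\<close> may refer to register 5 and to the memory, which loading arguments preserves.\<close>

lemma dyn_solvableI:
  fixes I :: "nat \<Rightarrow> edge_array \<Rightarrow> nat \<Rightarrow> nat list \<Rightarrow> bool"
  assumes depth: "loop_depth i \<le> Suc du" "loop_depth a \<le> du" "loop_depth d \<le> du" "loop_depth q \<le> dq"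
    and legal: "\<And>G xs. legal G xs \<Longrightarrow> length xs \<le> 5"
    and space: "\<And>n es c xs. I n es c xs \<Longrightarrow> length xs \<le> (length es + 1) ^ ds"
    and init: "\<And>n W es. (n + 2) ^ 16 \<le> W \<Longrightarrow> represents_graph n es \<Longrightarrow>
      wp W n es ((length es + 1) ^ ds) i (\<lambda>\<sigma>. I n es (regs \<sigma> 5) (mem \<sigma>)) start"
    and ins: "\<And>n W es es' u v \<sigma>. (n + 2) ^ 16 \<le> W \<Longrightarrow> represents_graph n es \<Longrightarrow>
      es' = insert_edge u v es \<Longrightarrow> represents_graph n es' \<Longrightarrow> {u, v} \<notin> edges (graph_of n es) \<Longrightarrow>
      I n es (regs \<sigma> 5) (mem \<sigma>) \<Longrightarrow> edge_regs u v \<sigma> \<Longrightarrow>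
      wp W n es' ((length es' + 1) ^ ds) a (\<lambda>\<sigma>. I n es' (regs \<sigma> 5) (mem \<sigma>)) \<sigma>"
    and del: "\<And>n W es es' u v \<sigma>. (n + 2) ^ 16 \<le> W \<Longrightarrow> represents_graph n es \<Longrightarrow>
      es' = delete_edge u v es \<Longrightarrow> {u, v} \<in> edges (graph_of n es) \<Longrightarrow>
      I n es (regs \<sigma> 5) (mem \<sigma>) \<Longrightarrow> edge_regs u v \<sigma> \<Longrightarrow>
      wp W n es ((length es' + 1) ^ ds) d (\<lambda>\<sigma>. I n es' (regs \<sigma> 5) (mem \<sigma>)) \<sigma>"
    and query: "\<And>n W es xs \<sigma>. (n + 2) ^ 16 \<le> W \<Longrightarrow> represents_graph n es \<Longrightarrow>
      legal (graph_of n es) xs \<Longrightarrow> I n es (regs \<sigma> 5) (mem \<sigma>) \<Longrightarrow>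
      wp W n es ((length es + 1) ^ ds) q
        (\<lambda>\<sigma>. I n es (regs \<sigma> 5) (mem \<sigma>) \<and> result \<sigma> = answer (graph_of n es) xs) (load xs \<sigma>)"
  shows "dyn_solvable legal answer (\<lambda>m. (m + 1) ^ du) (\<lambda>m. (m + 1) ^ dq) (\<lambda>m. (m + 1) ^ ds)"
proof -
  let ?D = "alg i a d q"
  \<comment> \<open>The summand 17 makes the word exponent at least 16 and pays for the extra
    \<open>Skip\<close>. The factor \<open>2 ^ du\<close> arises because a deletion runs on an array
    with one edge more than the array in the bound.\<close>
  define C where "C = 17 + com_cost 1 i + com_cost 1 a + com_cost 1 d * 2 ^ du + com_cost 1 q"
  have cost: "com_cost m c \<le> com_cost 1 c * (m + 1) ^ e" if "loop_depth c \<le> e" for m c e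
    by (rule order_trans[OF com_cost_le]) (intro mult_le_mono power_increasing order_refl that, simp)
  \<comment> \<open>By determinism, the postconditions of the given programs hold for the runs
    contained in \<open>perform\<close>.\<close>
  have step: "I n es' (regs \<sigma>' 5) (mem \<sigma>') \<and> represents_graph n es'"
    if "(n + 2) ^ 16 \<le> W" "represents_graph n es" "I n es (regs \<sigma> 5) (mem \<sigma>)"
      "admissible legal (graph_of n es) x" "perform W n ?D x es \<sigma> t s es' \<sigma>'"
    for n W es es' \<sigma> \<sigma>' x t s
    using that(5)
  proof cases
    case (perform_Insert u v t1 s1 \<sigma>1 t2 s2)
    have "\<sigma>1 = load [u, v] \<sigma>"
      using perform_Insert by (auto elim: run_SkipE)
    moreover have "represents_graph n es'"
      unfolding perform_Insert using that(2,4) perform_Insert(1)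
      by (intro represents_graph_insert_edge) auto
    ultimately show ?thesis
      using wp_run[OF ins[OF that(1,2) perform_Insert(5), of "load [u, v] \<sigma>1"]] that perform_Insert
      by simp
  next
    case (perform_Delete u v t1 s1 \<sigma>1 t2 s2)
    have uv: "{u, v} \<in> edges (graph_of n es)"
      using that(4) perform_Delete(1) by simp
    have "\<sigma>' = load [u, v] \<sigma>1"
      using perform_Delete by (auto elim: run_SkipE)
    moreover have "I n es' (regs \<sigma>1 5) (mem \<sigma>1)"
      using wp_run[OF del[OF that(1,2) perform_Delete(5) uv, of "load [u, v] \<sigma>"]] that perform_Delete
      by simp
    ultimately show ?thesis
      using delete_edge(1)[OF that(2) uv] perform_Delete by simp
  next
    case (perform_Query xs)
    then show ?thesis
      using wp_run[OF query[OF that(1,2), of xs \<sigma>]] that by auto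
  qed
  have inv: "I n es (regs \<sigma> 5) (mem \<sigma>) \<and> represents_graph n es"
    if W: "(n + 2) ^ 16 \<le> W" and "reachable W n ?D legal es \<sigma>" for n W es \<sigma>
    using that(2)
  proof induction
    case (reachable_init es t s \<sigma>)
    then show ?case
      using wp_run[OF init[OF W]] by simp
  next
    case (reachable_step es \<sigma> x t s es' \<sigma>')
    then show ?case
      using step[OF W] by blast
  qed
  have perf: "\<exists>t s es' \<sigma>'. perform W n ?D x es \<sigma> t s es' \<sigma>' \<and>
      t \<le> C * op_bound (\<lambda>m. (m + 1) ^ du) (\<lambda>m. (m + 1) ^ dq) x (length es') \<and>
      s \<le> C * (length es' + 1) ^ ds \<and> (\<forall>xs. x = Query xs \<longrightarrow> result \<sigma>' = answer (graph_of n es) xs)"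
    if W: "(n + 2) ^ 16 \<le> W" and rep: "represents_graph n es" and I: "I n es (regs \<sigma> 5) (mem \<sigma>)"
      and adm: "admissible legal (graph_of n es) x" for n W es \<sigma> x
  proof (cases x)
    case (Insert u v)
    let ?\<sigma> = "load [u, v] \<sigma>" and ?es' = "insert_edge u v es"
    have uv: "{u, v} \<notin> edges (graph_of n es)" and rep': "represents_graph n ?es'"
      using adm Insert rep by (auto intro!: represents_graph_insert_edge)
    let ?m = "length ?es'"
    have len: "?m = Suc (length es)"
      by (simp add: insert_edge_def)
    have "wp W n ?es' ((?m + 1) ^ ds) a (\<lambda>\<sigma>. I n ?es' (regs \<sigma> 5) (mem \<sigma>)) (load [u, v] ?\<sigma>)"
      using I by (intro ins[OF W rep refl rep' uv]) simp_all
    then obtain t s \<sigma>' where run: "run W n ?es' a (load [u, v] ?\<sigma>) t s \<sigma>'"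
      and t: "t \<le> com_cost ?m a" and s: "s \<le> (?m + 1) ^ ds"
      unfolding wp_def by blast
    have "perform W n ?D (Insert u v) es \<sigma> (1 + t) (max (length (mem ?\<sigma>)) s) ?es' \<sigma>'"
      using perform_Insert[OF _ refl, of W n es ?D u v \<sigma> 1 "length (mem ?\<sigma>)" ?\<sigma> t s \<sigma>'] run run_Skip
      by (simp only: alg_simps)
    moreover have "1 + t \<le> C * (?m + 1) ^ du"
    proof -
      have "1 + t \<le> (1 + com_cost 1 a) * (?m + 1) ^ du"
        using t cost[OF depth(2), of ?m] one_le_power[of "?m + 1" du]
        by (simp only: distrib_right) linarith
      also have "\<dots> \<le> C * (?m + 1) ^ du"
        by (intro mult_le_mono order_refl) (simp add: C_def)
      finally show ?thesis .
    qed
    moreover have "max (length (mem ?\<sigma>)) s \<le> C * (?m + 1) ^ ds"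
    proof -
      have "length (mem \<sigma>) \<le> (length es + 1) ^ ds"
        using space[OF I] .
      also have "\<dots> \<le> (?m + 1) ^ ds"
        by (rule power_mono) (simp_all add: len)
      finally have "max (length (mem ?\<sigma>)) s \<le> 1 * (?m + 1) ^ ds"
        using s by simp
      also have "\<dots> \<le> C * (?m + 1) ^ ds"
        by (intro mult_le_mono order_refl) (simp add: C_def)
      finally show ?thesis .
    qed
    ultimately show ?thesis
      unfolding Insert by (intro exI conjI) (assumption | simp)+
  next
    case (Delete u v)
    let ?\<sigma> = "load [u, v] \<sigma>" and ?es' = "delete_edge u v es"
    have uv: "{u, v} \<in> edges (graph_of n es)"
      using adm Delete by simp
    let ?m = "length ?es'"
    have len: "length es = Suc ?m"
      by (rule delete_edge(2)[OF rep uv])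
    have "wp W n es ((?m + 1) ^ ds) d (\<lambda>\<sigma>. I n ?es' (regs \<sigma> 5) (mem \<sigma>)) ?\<sigma>"
      using I by (intro del[OF W rep refl uv]) simp_all
    then obtain t s \<sigma>' where run: "run W n es d ?\<sigma> t s \<sigma>'"
      and t: "t \<le> com_cost (Suc ?m) d" and s: "s \<le> (?m + 1) ^ ds" and I': "I n ?es' (regs \<sigma>' 5) (mem \<sigma>')"
      unfolding wp_def len by blast
    have "perform W n ?D (Delete u v) es \<sigma> (t + 1) (max s (length (mem (load [u, v] \<sigma>')))) ?es'
        (load [u, v] \<sigma>')"
      using perform_Delete[OF _ refl, of W n es ?D u v \<sigma> t s \<sigma>' 1] run run_Skip
      by (simp only: alg_simps)
    moreover have "t + 1 \<le> C * (?m + 1) ^ du"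
    proof -
      \<comment> \<open>The old array has m + 1 edges, and m + 2 \<le> 2(m + 1).\<close>
      have "(Suc ?m + 1) ^ du \<le> (2 * (?m + 1)) ^ du"
        by (rule power_mono) simp_all
      then have "com_cost 1 d * (Suc ?m + 1) ^ du \<le> com_cost 1 d * 2 ^ du * (?m + 1) ^ du"
        by (simp only: power_mult_distrib mult.assoc mult_le_mono)
      then have "t + 1 \<le> (com_cost 1 d * 2 ^ du + 1) * (?m + 1) ^ du"
        using t cost[OF depth(3), of "Suc ?m"] one_le_power[of "?m + 1" du]
        by (simp only: distrib_right) linarith
      also have "\<dots> \<le> C * (?m + 1) ^ du"
        by (intro mult_le_mono order_refl) (simp add: C_def)
      finally show ?thesis .
    qed
    moreover have "max s (length (mem (load [u, v] \<sigma>'))) \<le> C * (?m + 1) ^ ds"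
    proof -
      have "max s (length (mem (load [u, v] \<sigma>'))) \<le> 1 * (?m + 1) ^ ds"
        using s space[OF I'] by simp
      also have "\<dots> \<le> C * (?m + 1) ^ ds"
        by (intro mult_le_mono order_refl) (simp add: C_def)
      finally show ?thesis .
    qed
    ultimately show ?thesis
      unfolding Delete by (intro exI conjI) (assumption | simp)+
  next
    case (Query xs)
    let ?m = "length es"
    have "legal (graph_of n es) xs"
      using adm Query by simp
    from query[OF W rep this I] obtain t s \<sigma>' where run: "run W n es q (load xs \<sigma>) t s \<sigma>'"
      and t: "t \<le> com_cost ?m q" and s: "s \<le> (?m + 1) ^ ds" and res: "result \<sigma>' = answer (graph_of n es) xs"
      unfolding wp_def by blast
    have "perform W n ?D (Query xs) es \<sigma> t s es \<sigma>'"
      by (rule perform_Query) (simp add: run)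
    moreover have "t \<le> C * (?m + 1) ^ dq"
    proof -
      have "t \<le> com_cost 1 q * (?m + 1) ^ dq"
        using t cost[OF depth(4)] order_trans by blast
      also have "\<dots> \<le> C * (?m + 1) ^ dq"
        by (intro mult_le_mono order_refl) (simp add: C_def)
      finally show ?thesis .
    qed
    moreover have "s \<le> C * (?m + 1) ^ ds"
    proof -
      have "1 * (?m + 1) ^ ds \<le> C * (?m + 1) ^ ds"
        by (intro mult_le_mono order_refl) (simp add: C_def)
      then show ?thesis using s by linarith
    qed
    ultimately show ?thesis
      unfolding Query using res by (intro exI conjI) (assumption | simp)+
  qed
  have initial: "\<exists>t s \<sigma>. run W n es i start t s \<sigma> \<and>
      t \<le> C * ((length es + 1) * (length es + 1) ^ du) \<and> s \<le> C * (length es + 1) ^ ds"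
    if W: "(n + 2) ^ 16 \<le> W" and rep: "represents_graph n es" for n W es
  proof -
    let ?m = "length es"
    from init[OF W rep] obtain t s \<sigma> where run: "run W n es i start t s \<sigma>"
      and t: "t \<le> com_cost ?m i" and s: "s \<le> (?m + 1) ^ ds"
      unfolding wp_def by blast
    have "t \<le> com_cost 1 i * (?m + 1) ^ Suc du"
      using t cost[OF depth(1)] order_trans by blast
    also have "\<dots> \<le> C * (?m + 1) ^ Suc du"
      by (intro mult_le_mono order_refl) (simp add: C_def)
    finally have "t \<le> C * ((?m + 1) * (?m + 1) ^ du)"
      by (simp only: power_Suc)
    moreover have "1 * (?m + 1) ^ ds \<le> C * (?m + 1) ^ ds"
      by (intro mult_le_mono order_refl) (simp add: C_def)
    ultimately show ?thesis
      using run s by (metis mult_1 order_trans)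
  qed
  have W: "(n + 2) ^ 16 \<le> (n + 2) ^ C" for n :: nat
    by (rule power_increasing) (simp_all add: C_def)
  show ?thesis
    unfolding dyn_solvable_def
  proof (rule exI[of _ ?D], rule exI[of _ C], intro allI impI conjI)
    fix n W :: nat and es assume "W = (n + 2) ^ C" "represents_graph n es"
    then show "\<exists>t s \<sigma>. run W n es (init_prog ?D) start t s \<sigma> \<and>
        t \<le> C * ((length es + 1) * (length es + 1) ^ du) \<and> s \<le> C * (length es + 1) ^ ds"
      using initial[OF W] by simp
  next
    fix n W :: nat and es \<sigma> x
    assume C: "W = (n + 2) ^ C" and reach: "reachable W n ?D legal es \<sigma>"
      and adm: "admissible legal (graph_of n es) x"
    have W': "(n + 2) ^ 16 \<le> W"
      unfolding C by (rule W)
    show "\<exists>t s es' \<sigma>'. perform W n ?D x es \<sigma> t s es' \<sigma>' \<and>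
        t \<le> C * op_bound (\<lambda>m. (m + 1) ^ du) (\<lambda>m. (m + 1) ^ dq) x (length es') \<and>
        s \<le> C * (length es' + 1) ^ ds \<and> (\<forall>xs. x = Query xs \<longrightarrow> result \<sigma>' = answer (graph_of n es) xs)"
      using inv[OF W' reach] perf[OF W' _ _ adm] by blast
  qed
qed

section \<open>Recomputing the count at each query\<close>

text \<open>Nothing is stored between operations; the invariant only says that the memory is
  empty.\<close>

lemma edge_count_solvable_by_scan:
  assumes P: "card (verts P) = 4"
  shows "edge_count_solvable P (\<lambda>m. (m + 1) ^ 0) (\<lambda>m. (m + 1) ^ 1) (\<lambda>m. (m + 1) ^ 0)"
  unfolding edge_count_solvable_def
proof (rule dyn_solvableI[where I = "\<lambda>n es c xs. xs = []" and i = Skip and a = Skip and d = Skip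
      and q = "Seq (count_prog P) (Assign 0 (Reg 4))"])
  fix n W es and \<sigma> :: machine and xs :: "nat list"
  assume W: "(n + 2) ^ 16 \<le> W" and rep: "represents_graph n es" and mem: "mem \<sigma> = []"
    and "\<exists>u v. xs = [u, v] \<and> {u, v} \<in> edges (graph_of n es)"
  then obtain u v where xs: "xs = [u, v]" "{u, v} \<in> edges (graph_of n es)" by blast
  have "subgraph_count_at (graph_of n es) P {u, v} < W"
    using subgraph_count_at_le[OF represents_graph_simple[OF rep] P xs(2)]
    by (intro word_bound[OF W, of 2 6]) auto
  then show "wp W n es ((length es + 1) ^ 0) (Seq (count_prog P) (Assign 0 (Reg 4)))
      (\<lambda>\<sigma>. mem \<sigma> = [] \<and> result \<sigma> = subgraph_count_at (graph_of n es) P (set xs)) (load xs \<sigma>)"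
    unfolding xs(1) using xs(2) mem
    by (intro wp_Seq wp_count_prog[OF rep P W] wp_Assign) (simp_all add: result_def)
qed (auto intro!: wp_Skip simp: start_def)

section \<open>Maintaining the total count\<close>

text \<open>Register 6 drives the outer loop because \<open>count_prog\<close> uses register 2 as
  its own counter.\<close>

definition load_edge :: com where
  "load_edge = Seq (Assign 0 (End1 (Reg 6))) (Assign 1 (End2 (Reg 6)))"

lemma wp_load_edge:
  assumes "represents_graph n es" "n \<le> W" "length (mem \<sigma>) \<le> S" "regs \<sigma> 6 = k" "k < length es"
    and "Q (\<sigma>\<lparr>regs := (regs \<sigma>)(0 := fst (es ! k), 1 := snd (es ! k))\<rparr>)"
  shows "wp W n es S load_edge Q \<sigma>"
proof -
  have "fst (es ! k) < n" "snd (es ! k) < n"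
    using represents_graph_nth(1,2)[OF assms(1,5) surjective_pairing] by auto
  then show ?thesis
    unfolding load_edge_def using assms
    by (intro wp_Seq wp_Assign) (simp_all add: nth_or_0_map set_reg_def)
qed

text \<open>Summing the counts over all edges counts every copy once for each of its edges.\<close>

definition total_init :: "'b ugraph \<Rightarrow> com" where
  "total_init P = Seq (For 6 (Seq load_edge (Seq (count_prog P) (Assign 5 (Plus (Reg 5) (Reg 4))))))
    (Assign 5 (Div (Reg 5) (Const (card (edges P)))))"

text \<open>Two distinct vertices are joined by a path, whose first step is an edge. The divisor in
  \<open>total_init\<close> is therefore positive.\<close>

lemma edge_set_nonempty:
  assumes "simple_graph P" "card (verts P) = 4" "connected_graph P"
  shows "card (edges P) > 0"
proof -
  have "\<not> is_singleton (verts P)" "verts P \<noteq> {}"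
    using assms(2) by (auto simp: is_singleton_altdef)
  then obtain u v where uv: "u \<in> verts P" "v \<in> verts P" "u \<noteq> v"
    by (metis is_singletonI' )
  then have "(u, v) \<in> {(x, y). {x, y} \<in> edges P}\<^sup>*"
    using assms(3) by (auto simp: connected_graph_def)
  then have "edges P \<noteq> {}"
    using uv(3) by (auto elim: converse_rtranclE)
  moreover have "finite (edges P)"
    using assms(1) by (auto simp: simple_graph_def intro: finite_subset[of _ "Pow (verts P)"])
  ultimately show ?thesis
    by (simp add: card_gt_0_iff)
qed

text \<open>At most n^2 edges, each with a count of at most 2^6 n^2. The sums accumulated during
  initialisation thus fit into a word.\<close>

lemma partial_sum_bound:
  assumes rep: "represents_graph n es" and P: "card (verts P) = 4" and k: "k \<le> length es"
  shows "(\<Sum>i<k. subgraph_count_at (graph_of n es) P (uedge (es ! i))) \<le> 2 ^ 6 * n ^ 4"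
proof -
  have "subgraph_count_at (graph_of n es) P (uedge (es ! i)) \<le> 2 ^ 6 * n ^ 2" if "i \<in> {..<k}" for i
    using subgraph_count_at_le[OF represents_graph_simple[OF rep] P, of "uedge (es ! i)"] that k
    by (simp add: edges_graph_of)
  from sum_bounded_above[of "{..<k}" "\<lambda>i. subgraph_count_at (graph_of n es) P (uedge (es ! i))", OF this]
  have "(\<Sum>i<k. subgraph_count_at (graph_of n es) P (uedge (es ! i))) \<le> k * (2 ^ 6 * n ^ 2)"
    by simp
  also have "\<dots> \<le> n ^ 2 * (2 ^ 6 * n ^ 2)"
    using length_le_square[OF rep] k by (intro mult_le_mono) auto
  finally show ?thesis
    by (simp add: algebra_simps flip: power_add)
qed

text \<open>Register 5 carries the total. Initialisation scans once for each edge, within the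
  allowed order of (m + 1)^2; an update adds or subtracts the count at the updated edge, taken in
  the graph that contains it.\<close>

lemma count_solvable_by_maintaining:
  assumes simple: "simple_graph P" and P: "card (verts P) = 4" and ne: "card (edges P) > 0"
  shows "count_solvable P (\<lambda>m. (m + 1) ^ 1) (\<lambda>m. (m + 1) ^ 0) (\<lambda>m. (m + 1) ^ 0)"
proof -
  have sum: "(\<Sum>i<length es. subgraph_count_at (graph_of n es) P (uedge (es ! i))) =
      card (edges P) * subgraph_count (graph_of n es) P" if "represents_graph n es" for n es
    unfolding sum_edge_array[OF that]
    by (rule sum_subgraph_count_at[OF represents_graph_simple[OF that] simple])
  have less: "subgraph_count (graph_of n es) P < W" if "represents_graph n es" "(n + 2) ^ 16 \<le> W" for n es W
  proof (rule word_bound[OF that(2), of 4 6])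
    have "1 * subgraph_count (graph_of n es) P \<le> card (edges P) * subgraph_count (graph_of n es) P"
      using ne by (intro mult_le_mono) auto
    then show "subgraph_count (graph_of n es) P \<le> 2 ^ 6 * n ^ 4"
      using partial_sum_bound[OF that(1) P order_refl] unfolding sum[OF that(1)] by linarith
  qed auto
  show ?thesis
    unfolding count_solvable_def
  proof (rule dyn_solvableI[where I = "\<lambda>n es c xs. c = subgraph_count (graph_of n es) P \<and> xs = []"
        and i = "total_init P" and a = "Seq (count_prog P) (Assign 5 (Plus (Reg 5) (Reg 4)))"
        and d = "Seq (count_prog P) (Assign 5 (Minus (Reg 5) (Reg 4)))" and q = "Assign 0 (Reg 5)"])
    fix n W es assume W: "(n + 2) ^ 16 \<le> W" and rep: "represents_graph n es"
    let ?c = "\<lambda>i. subgraph_count_at (graph_of n es) P (uedge (es ! i))"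
    have m: "length es < W"
      using length_le_square[OF rep] by (intro word_bound[OF W, of 2 0]) auto
    have n: "n < W"
      by (intro word_bound[OF W, of 1 0]) auto
    show "wp W n es ((length es + 1) ^ 0) (total_init P)
      (\<lambda>\<sigma>. regs \<sigma> 5 = subgraph_count (graph_of n es) P \<and> mem \<sigma> = []) start"
      unfolding total_init_def
    proof (rule wp_Seq, rule wp_For[where I = "\<lambda>k \<sigma>. regs \<sigma> 5 = (\<Sum>i<k. ?c i) \<and> mem \<sigma> = []"])
      fix k and \<sigma> :: machine assume k: "k < length es" and I: "regs \<sigma> 5 = (\<Sum>i<k. ?c i) \<and> mem \<sigma> = []"
        and r: "regs \<sigma> 6 = k"
      have e: "{fst (es ! k), snd (es ! k)} \<in> edges (graph_of n es)"
        by (rule represents_graph_nth(4)[OF rep k]) simp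
      have "(\<Sum>i<Suc k. ?c i) < W"
        by (rule word_bound[OF W _ _ partial_sum_bound[OF rep P]]) (use k in auto)
      then have bound: "(\<Sum>i<k. ?c i) + ?c k < W"
        by simp
      show "wp W n es ((length es + 1) ^ 0) (Seq load_edge (Seq (count_prog P) (Assign 5 (Plus (Reg 5) (Reg 4)))))
        (\<lambda>\<sigma>'. regs \<sigma>' 6 = k \<and> length (mem \<sigma>') \<le> (length es + 1) ^ 0 \<and>
          regs (set_reg 6 (Suc k) \<sigma>') 5 = (\<Sum>i<Suc k. ?c i) \<and> mem (set_reg 6 (Suc k) \<sigma>') = []) \<sigma>"
        using n I r k e bound
        by (intro wp_Seq wp_load_edge[OF rep _ _ r k] wp_count_prog[OF rep P W] wp_Assign)
          (simp_all add: uedge_def)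
    next
      fix \<sigma> :: machine assume I: "regs \<sigma> 5 = (\<Sum>i<length es. ?c i) \<and> mem \<sigma> = []"
      then show "wp W n es ((length es + 1) ^ 0) (Assign 5 (Div (Reg 5) (Const (card (edges P)))))
        (\<lambda>\<sigma>. regs \<sigma> 5 = subgraph_count (graph_of n es) P \<and> mem \<sigma> = []) \<sigma>"
        using less[OF rep W] ne sum[OF rep] by (intro wp_Assign) simp_all
    qed (use m in \<open>simp_all add: start_def\<close>)
  next
    fix n W es es' u v and \<sigma> :: machine
    assume W: "(n + 2) ^ 16 \<le> W" and rep: "represents_graph n es" and es': "es' = insert_edge u v es"
      and rep': "represents_graph n es'" and uv: "{u, v} \<notin> edges (graph_of n es)"
      and I: "regs \<sigma> 5 = subgraph_count (graph_of n es) P \<and> mem \<sigma> = []" and r: "edge_regs u v \<sigma>"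
    have G': "graph_of n es' = ({..<n}, insert {u, v} (edges (graph_of n es)))"
      by (simp add: es' graph_of_insert_edge)
    then have uv': "{u, v} \<in> edges (graph_of n es')"
      by simp
    have "subgraph_count (graph_of n es') P =
        subgraph_count (graph_of n es) P + subgraph_count_at (graph_of n es') P {u, v}"
      using subgraph_count_insert[OF _ uv, of "{..<n}" P] represents_graph_simple[OF rep']
      unfolding G'[symmetric] by simp
    then show "wp W n es' ((length es' + 1) ^ 0) (Seq (count_prog P) (Assign 5 (Plus (Reg 5) (Reg 4))))
      (\<lambda>\<sigma>. regs \<sigma> 5 = subgraph_count (graph_of n es') P \<and> mem \<sigma> = []) \<sigma>"
      using less[OF rep' W] I r uv'
      by (intro wp_Seq wp_count_prog[OF rep' P W] wp_Assign) (simp_all add: edge_regs_def)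
  next
    fix n W es es' u v and \<sigma> :: machine
    assume W: "(n + 2) ^ 16 \<le> W" and rep: "represents_graph n es" and es': "es' = delete_edge u v es"
      and uv: "{u, v} \<in> edges (graph_of n es)"
      and I: "regs \<sigma> 5 = subgraph_count (graph_of n es) P \<and> mem \<sigma> = []" and r: "edge_regs u v \<sigma>"
    note del = delete_edge[OF rep uv, folded es']
    have "subgraph_count (graph_of n es) P =
        subgraph_count (graph_of n es') P + subgraph_count_at (graph_of n es) P {u, v}"
      using subgraph_count_insert[OF _ del(3), of "{..<n}" P] represents_graph_simple[OF rep]
      unfolding del(4)[symmetric] by simp
    then show "wp W n es ((length es' + 1) ^ 0) (Seq (count_prog P) (Assign 5 (Minus (Reg 5) (Reg 4))))
      (\<lambda>\<sigma>. regs \<sigma> 5 = subgraph_count (graph_of n es') P \<and> mem \<sigma> = []) \<sigma>"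
      using less[OF del(1) W] I r uv
      by (intro wp_Seq wp_count_prog[OF rep P W] wp_Assign) (simp_all add: edge_regs_def)
  next
    fix n W es and xs :: "nat list" and \<sigma> :: machine
    assume W: "(n + 2) ^ 16 \<le> W" and rep: "represents_graph n es" and xs: "xs = []"
      and I: "regs \<sigma> 5 = subgraph_count (graph_of n es) P \<and> mem \<sigma> = []"
    then show "wp W n es ((length es + 1) ^ 0) (Assign 0 (Reg 5))
      (\<lambda>\<sigma>. (regs \<sigma> 5 = subgraph_count (graph_of n es) P \<and> mem \<sigma> = []) \<and>
        result \<sigma> = subgraph_count (graph_of n es) P) (load xs \<sigma>)"
      using less[OF rep W] by (intro wp_Assign) (simp_all add: result_def)
  qed (simp_all add: total_init_def load_edge_def)
qed

section \<open>Maintaining the counts at all edges\<close>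

text \<open>
  Cell \<open>j\<close> holds the count at the edge in position \<open>j\<close>. The cell of the updated edge itself is left
  alone by \<^const>\<open>delta_prog\<close>.
\<close>

definition table_init :: "'b ugraph \<Rightarrow> com" where
  "table_init P =
    For 6 (Seq Grow (Seq load_edge (Seq (count_prog P) (Store (Reg 6) (Reg 4)))))"

text \<open>The new cell comes first, so that memory and array have equal length during the scan.
  Register 4 survives \<open>delta_prog\<close> and is stored at the last position, where the new
  edge sits.\<close>

definition table_insert :: "'b ugraph \<Rightarrow> com" where
  "table_insert P = Seq Grow (Seq (count_prog P) (Seq (delta_prog True P)
    (Store (Minus NumE (Const 1)) (Reg 4))))"

text \<open>Mirrors \<open>delete_edge\<close>: the last cell moves to the place of the deleted
  edge, then the memory shrinks. If that edge is itself last, its cell is just dropped.\<close>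

definition table_delete :: "'b ugraph \<Rightarrow> com" where
  "table_delete P = Seq (count_prog P) (Seq (delta_prog False P)
    (Seq (Store (Pos (Reg 0) (Reg 1)) (Mem (Minus NumE (Const 1)))) Shrink))"

definition count_table :: "'b ugraph \<Rightarrow> nat \<Rightarrow> edge_array \<Rightarrow> nat list" where
  "count_table P n es = map (\<lambda>p. subgraph_count_at (graph_of n es) P (uedge p)) es"

lemma length_count_table [simp]: "length (count_table P n es) = length es"
  by (simp add: count_table_def)

lemma count_less:
  assumes "represents_graph n es" "card (verts P) = 4" "(n + 2) ^ 16 \<le> W" "e \<in> edges (graph_of n es)"
  shows "subgraph_count_at (graph_of n es) P e < W"
  using subgraph_count_at_le[OF represents_graph_simple[OF assms(1)] assms(2,4)]
  by (intro word_bound[OF assms(3), of 2 6]) auto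

text \<open>Cells are allocated one at a time, so after \<open>k\<close> iterations the memory is
  the prefix of length \<open>k\<close> of the final table.\<close>

lemma wp_table_init:
  assumes P: "card (verts P) = 4" and W: "(n + 2) ^ 16 \<le> W" and rep: "represents_graph n es"
  shows "wp W n es (length es + 1) (table_init P) (\<lambda>\<sigma>. mem \<sigma> = count_table P n es) start"
  unfolding table_init_def
proof (rule wp_For[where I = "\<lambda>k \<sigma>. mem \<sigma> = take k (count_table P n es)"])
  show m: "length es < W"
    using length_le_square[OF rep] by (intro word_bound[OF W, of 2 0]) auto
  have n: "n < W"
    by (intro word_bound[OF W, of 1 0]) auto
  let ?c = "\<lambda>i. subgraph_count_at (graph_of n es) P (uedge (es ! i))"
  fix k and \<sigma> :: machine assume k: "k < length es" and I: "mem \<sigma> = take k (count_table P n es)" and r: "regs \<sigma> 6 = k"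
  have e: "{fst (es ! k), snd (es ! k)} \<in> edges (graph_of n es)"
    by (rule represents_graph_nth(4)[OF rep k]) simp
  have len: "length (take k (count_table P n es)) = k"
    using k by (simp add: count_table_def)
  have len': "length (take (Suc k) (count_table P n es)) \<le> Suc (length es)"
    using k by simp
  have c: "{fst (es ! k), snd (es ! k)} = uedge (es ! k)"
    by (simp add: uedge_def)
  have cl: "?c k < W"
    by (rule count_less[OF rep P W]) (use e in \<open>simp add: c\<close>)
  have t: "take k (count_table P n es) @ [?c k] = take (Suc k) (count_table P n es)"
    using k by (simp add: count_table_def take_Suc_conv_app_nth)
  let ?Q = "\<lambda>\<sigma>'. regs \<sigma>' 6 = k \<and> length (mem \<sigma>') \<le> length es + 1 \<and>
      mem (set_reg 6 (Suc k) \<sigma>') = take (Suc k) (count_table P n es)"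
  have store: "wp W n es (length es + 1) (Store (Reg 6) (Reg 4)) ?Q \<sigma>'"
    if "mem \<sigma>' = take k (count_table P n es) @ [0]" "regs \<sigma>' 6 = k" "regs \<sigma>' 4 = ?c k" for \<sigma>'
    using that k cl len t len'
    by (intro wp_Store) (simp_all add: list_update_append del: length_take)
  show "wp W n es (length es + 1) (Seq Grow (Seq load_edge (Seq (count_prog P) (Store (Reg 6) (Reg 4))))) ?Q \<sigma>"
    using k len n I r e
    by (intro wp_Seq wp_Grow wp_load_edge[OF rep, of _ _ _ k] wp_count_prog[OF rep P W] store)
      (simp_all add: c del: length_take)
qed (simp_all add: start_def count_table_def)

text \<open>For old edges, \<open>subgraph_count_at_insert\<close> identifies the change with
  \<open>D\<close>. The new cell starts at 0, stays so because \<open>D\<close> vanishes at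
  \<open>uv\<close>, and receives its count at the end.\<close>

lemma wp_table_insert:
  assumes P: "card (verts P) = 4" and W: "(n + 2) ^ 16 \<le> W"
    and es': "es' = insert_edge u v es"
    and rep': "represents_graph n es'" and uv: "{u, v} \<notin> edges (graph_of n es)"
    and mem: "mem \<sigma> = count_table P n es" and r: "edge_regs u v \<sigma>"
  shows "wp W n es' (length es' + 1) (table_insert P) (\<lambda>\<sigma>. mem \<sigma> = count_table P n es') \<sigma>"
proof -
  let ?m = "length es" and ?G' = "graph_of n es'"
  have G': "?G' = ({..<n}, insert {u, v} (edges (graph_of n es)))"
    by (simp add: es' graph_of_insert_edge)
  have uv': "{u, v} \<in> edges ?G'"
    by (simp add: G')
  have m: "length es' < W"
    using length_le_square[OF rep'] by (intro word_bound[OF W, of 2 0]) auto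
  have len: "length es' = Suc ?m" and es'_nth: "j < ?m \<Longrightarrow> es' ! j = es ! j" "es' ! ?m = (u, v)" for j
    by (simp_all add: es' insert_edge_def nth_append)
  define D where "D = (\<lambda>e. if e = {u, v} then 0 else joint_count ?G' P e {u, v})"
  have D: "subgraph_count_at (graph_of n es) P (uedge (es ! j)) + D (uedge (es' ! j)) =
      subgraph_count_at ?G' P (uedge (es' ! j))" if "j < ?m" for j
  proof -
    have "uedge (es ! j) \<in> edges (graph_of n es)"
      using that by (simp add: edges_graph_of)
    then have "uedge (es ! j) \<noteq> {u, v}"
      using uv by metis
    then show ?thesis
      using subgraph_count_at_insert[OF _ uv, of "{..<n}" P "uedge (es ! j)"]
        represents_graph_simple[OF rep'] es'_nth(1)[OF that]
      unfolding G'[symmetric] by (simp add: D_def)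
  qed
  let ?M = "count_table P n es @ [0]"
  have M: "acc True (?M ! j) (D (uedge (es' ! j))) =
      (if j = ?m then 0 else subgraph_count_at ?G' P (uedge (es' ! j)))" if "j < length es'" for j
  proof (cases "j = ?m")
    case True
    then show ?thesis
      by (simp add: acc_def nth_append count_table_def es'_nth(2) D_def uedge_def)
  next
    case False
    then show ?thesis
      using that D[of j] len by (simp add: acc_def nth_append count_table_def)
  qed
  have in': "uedge (es' ! j) \<in> edges ?G'" if "j < length es'" for j
    using that by (simp add: edges_graph_of)
  have bound: "?M ! j < W \<and> (True \<longrightarrow> ?M ! j + D (uedge (es' ! j)) < W)" if "j < length es'" for j
  proof -
    have "acc True (?M ! j) (D (uedge (es' ! j))) < W"
      using M[OF that] count_less[OF rep' P W in'[OF that]] m by auto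
    then show ?thesis by (auto simp: acc_def)
  qed
  have table: "(map (\<lambda>j. acc True (?M ! j) (D (uedge (es' ! j)))) [0..<length es'])
      [?m := subgraph_count_at ?G' P {u, v}] = count_table P n es'"
  proof (rule nth_equalityI, goal_cases)
    case (2 i)
    then have i: "i < length es'" by simp
    have "uedge (es' ! ?m) = {u, v}"
      by (simp add: es'_nth(2) uedge_def)
    moreover have "count_table P n es' ! i = subgraph_count_at ?G' P (uedge (es' ! i))"
      using i by (simp add: count_table_def)
    ultimately show ?case
      using i M[OF i] len by (cases "i = ?m") (simp_all del: upt_Suc)
  qed simp
  let ?Q = "\<lambda>\<sigma>. mem \<sigma> = count_table P n es'"
  have store: "wp W n es' (length es' + 1) (Store (Minus NumE (Const 1)) (Reg 4)) ?Q \<sigma>'"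
    if "mem \<sigma>' = map (\<lambda>j. acc True (?M ! j) (D (uedge (es' ! j)))) [0..<length es']"
      "regs \<sigma>' 4 = subgraph_count_at ?G' P {u, v}" for \<sigma>'
    using that len table count_less[OF rep' P W uv'] by (intro wp_Store) simp_all
  have delta: "wp W n es' (length es' + 1) (delta_prog True P)
      (wp W n es' (length es' + 1) (Store (Minus NumE (Const 1)) (Reg 4)) ?Q) \<sigma>'"
    if mem': "mem \<sigma>' = ?M" and "edge_regs u v \<sigma>'" and "regs \<sigma>' 3 = common ?G' u v True True"
      and "regs \<sigma>' 4 = subgraph_count_at ?G' P {u, v}" for \<sigma>'
  proof -
    have r': "regs \<sigma>' 0 = u" "regs \<sigma>' 1 = v"
      using that(2) by (simp_all only: edge_regs_def)
    show ?thesis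
    proof (rule wp_delta_prog[OF rep' P m, where D = D], unfold r' mem', goal_cases)
      case 7
      then show ?case
        by (rule store) (use that(4) in simp_all)
    qed (use that(3) uv' len bound in \<open>simp_all add: D_def[symmetric]\<close>)
  qed
  show ?thesis
    unfolding table_insert_def using r uv' len mem
    by (intro wp_Seq wp_Grow wp_count_prog[OF rep' P W] delta)
      (simp_all add: edge_regs_def count_table_def)
qed

text \<open>Subtracting the joint counts gives the new count at each remaining edge, while the cell
  of \<open>uv\<close> keeps its old value until it is overwritten or dropped. The memory never
  exceeds \<open>length es\<close>, which is \<open>length es' + 1\<close>.\<close>

lemma wp_table_delete:
  assumes P: "card (verts P) = 4" and W: "(n + 2) ^ 16 \<le> W"
    and rep: "represents_graph n es" and uv: "{u, v} \<in> edges (graph_of n es)"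
    and es': "es' = delete_edge u v es"
    and mem: "mem \<sigma> = count_table P n es" and r: "edge_regs u v \<sigma>"
  shows "wp W n es (length es' + 1) (table_delete P) (\<lambda>\<sigma>. mem \<sigma> = count_table P n es') \<sigma>"
proof -
  note del = delete_edge[OF rep uv, folded es']
  let ?G = "graph_of n es" and ?G' = "graph_of n es'"
  have m: "length es < W"
    using length_le_square[OF rep] by (intro word_bound[OF W, of 2 0]) auto
  define D where "D = (\<lambda>e. if e = {u, v} then 0 else joint_count ?G P e {u, v})"
  define h where "h = (\<lambda>p. if uedge p = {u, v} then subgraph_count_at ?G P {u, v}
    else subgraph_count_at ?G' P (uedge p))"
  have "subgraph_count_at ?G P e = subgraph_count_at ?G' P e + joint_count ?G P e {u, v}" for e
    using subgraph_count_at_insert[OF _ del(3), of "{..<n}" P e] represents_graph_simple[OF rep]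
    unfolding del(4)[symmetric] by simp
  then have h: "acc False (count_table P n es ! j) (D (uedge (es ! j))) = h (es ! j)"
    if "j < length es" for j
    using that by (simp add: count_table_def acc_def D_def h_def)
  have M: "map (\<lambda>j. acc False (count_table P n es ! j) (D (uedge (es ! j)))) [0..<length es] = map h es"
    by (rule nth_equalityI) (simp_all add: h)
  let ?k = "edge_pos es u v"
  note k = edge_pos(1)[OF uv]
  have ne: "es \<noteq> []" using k by auto
  \<comment> \<open>The cells are moved exactly as the entries of the array are, so the update
    commutes with \<open>map h\<close>.\<close>
  have "butlast ((map h es)[?k := last (map h es)]) = map h es'"
    using ne by (simp add: es' delete_edge_def butlast_list_update map_butlast last_map map_update
        list_update_beyond)
  also have "\<dots> = count_table P n es'"
  proof -
    have "uedge p \<noteq> {u, v}" if "p \<in> set es'" for p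
      using that del(3) by (force simp: edges_graph_of)
    then show ?thesis by (simp add: count_table_def h_def)
  qed
  finally have table: "butlast ((map h es)[?k := last (map h es)]) = count_table P n es'" .
  have in': "uedge (es ! j) \<in> edges ?G" if "j < length es" for j
    using that by (simp add: edges_graph_of)
  have bound: "count_table P n es ! j < W" if "j < length es" for j
    using that count_less[OF rep P W in'[OF that]] by (simp add: count_table_def)
  have last: "map h es ! (length es - 1) = last (map h es)"
    using ne by (simp add: last_conv_nth)
  have "last (map h es) < W"
  proof -
    have j: "length es - 1 < length es" using ne by simp
    have "h (es ! (length es - 1)) \<le> count_table P n es ! (length es - 1)"
      unfolding h[OF j, symmetric] by (simp add: acc_def)
    then show ?thesis
      using bound[OF j] last j by simp
  qed
  then have store: "wp W n es (length es' + 1)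
      (Seq (Store (Pos (Reg 0) (Reg 1)) (Mem (Minus NumE (Const 1)))) Shrink)
      (\<lambda>\<sigma>. mem \<sigma> = count_table P n es') \<sigma>'"
    if "mem \<sigma>' = map h es" "edge_regs u v \<sigma>'" for \<sigma>'
    using that k table last ne del(2)
    by (intro wp_Seq wp_Store wp_Shrink) (simp_all add: edge_regs_def nth_or_0_def)
  have delta: "wp W n es (length es' + 1) (delta_prog False P) (wp W n es (length es' + 1)
      (Seq (Store (Pos (Reg 0) (Reg 1)) (Mem (Minus NumE (Const 1)))) Shrink)
      (\<lambda>\<sigma>. mem \<sigma> = count_table P n es')) \<sigma>'"
    if mem': "mem \<sigma>' = count_table P n es" and "edge_regs u v \<sigma>'"
      and "regs \<sigma>' 3 = common ?G u v True True" for \<sigma>'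
  proof -
    have r': "regs \<sigma>' 0 = u" "regs \<sigma>' 1 = v"
      using that(2) by (simp_all only: edge_regs_def)
    show ?thesis
    proof (rule wp_delta_prog[OF rep P m, where D = D], unfold r' mem' M, goal_cases)
      case 7
      then show ?case
        by (rule store) (use that(2) in \<open>simp_all add: edge_regs_def\<close>)
    qed (use that(3) uv bound del(2) in \<open>simp_all add: D_def[symmetric]\<close>)
  qed
  show ?thesis
    unfolding table_delete_def using r uv mem del(2)
    by (intro wp_Seq wp_count_prog[OF rep P W] delta) (simp_all add: edge_regs_def count_table_def)
qed

text \<open>One cell for each edge gives linear space, and \<open>Pos\<close> locates the cell of a
  queried edge in constant time.\<close>

lemma edge_count_solvable_by_table:
  assumes P: "card (verts P) = 4"
  shows "edge_count_solvable P (\<lambda>m. (m + 1) ^ 1) (\<lambda>m. (m + 1) ^ 0) (\<lambda>m. (m + 1) ^ 1)"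
  unfolding edge_count_solvable_def
proof (rule dyn_solvableI[where I = "\<lambda>n es c xs. xs = count_table P n es" and i = "table_init P"
      and a = "table_insert P" and d = "table_delete P" and q = "Assign 0 (Mem (Pos (Reg 0) (Reg 1)))"])
  fix n W es and \<sigma> :: machine and xs :: "nat list"
  assume W: "(n + 2) ^ 16 \<le> W" and rep: "represents_graph n es" and mem: "mem \<sigma> = count_table P n es"
    and "\<exists>u v. xs = [u, v] \<and> {u, v} \<in> edges (graph_of n es)"
  then obtain u v where xs: "xs = [u, v]" and uv: "{u, v} \<in> edges (graph_of n es)" by blast
  have "nth_or_0 (count_table P n es) (edge_pos es u v) = subgraph_count_at (graph_of n es) P {u, v}"
    using edge_pos[OF uv] by (simp add: nth_or_0_def count_table_def)
  then show "wp W n es ((length es + 1) ^ 1) (Assign 0 (Mem (Pos (Reg 0) (Reg 1))))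
      (\<lambda>\<sigma>. mem \<sigma> = count_table P n es \<and> result \<sigma> = subgraph_count_at (graph_of n es) P (set xs))
      (load xs \<sigma>)"
    using count_less[OF rep P W uv] mem
    by (intro wp_Assign) (simp_all add: xs result_def count_table_def)
next
  fix n W es assume "(n + 2) ^ 16 \<le> W" "represents_graph n es"
  from wp_table_init[OF P this]
  show "wp W n es ((length es + 1) ^ 1) (table_init P) (\<lambda>\<sigma>. mem \<sigma> = count_table P n es) start"
    by (simp only: power_one_right)
next
  fix n W es es' u v and \<sigma> :: machine
  assume "(n + 2) ^ 16 \<le> W" "es' = insert_edge u v es" "represents_graph n es'"
    "{u, v} \<notin> edges (graph_of n es)" "mem \<sigma> = count_table P n es" "edge_regs u v \<sigma>"
  from wp_table_insert[OF P this]
  show "wp W n es' ((length es' + 1) ^ 1) (table_insert P) (\<lambda>\<sigma>. mem \<sigma> = count_table P n es') \<sigma>"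
    by (simp only: power_one_right)
next
  fix n W es es' u v and \<sigma> :: machine
  assume "(n + 2) ^ 16 \<le> W" "represents_graph n es" "{u, v} \<in> edges (graph_of n es)"
    "es' = delete_edge u v es" "mem \<sigma> = count_table P n es" "edge_regs u v \<sigma>"
  from wp_table_delete[OF P this]
  show "wp W n es ((length es' + 1) ^ 1) (table_delete P) (\<lambda>\<sigma>. mem \<sigma> = count_table P n es') \<sigma>"
    by (simp only: power_one_right)
qed (auto simp: table_init_def table_insert_def table_delete_def load_edge_def count_table_def)

theorem theorem3p2:
  fixes P :: "'a ugraph"
  assumes "simple_graph P" and "card (verts P) = 4" and "connected_graph P"
  shows "count_solvable P (\<lambda>m. m + 1) (\<lambda>m. 1) (\<lambda>m. 1)
    \<and> edge_count_solvable P (\<lambda>m. 1) (\<lambda>m. m + 1) (\<lambda>m. 1)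
    \<and> edge_count_solvable P (\<lambda>m. m + 1) (\<lambda>m. 1) (\<lambda>m. m + 1)"
  using count_solvable_by_maintaining[OF assms(1,2) edge_set_nonempty[OF assms]]
    edge_count_solvable_by_scan[OF assms(2)] edge_count_solvable_by_table[OF assms(2)]
  by simp

end
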